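(* Let $F$ be a field of characteristic $0$ and $\mathcal{H}=(\pmb{\Gamma}^i)_{i\ge0}$, where $\pmb{\Gamma}$ is the sequence $(0,1,2,\ldots)$. Let $A\in M_q(F)$ be a square matrix whose characteristic polynomial splits over $F$. Then the sequence of matrices obtained by plugging $-k$ for $k$ in the geometric part of $A$ relative to $(\mathcal{S}^{\ast},\mathcal{H})$ is $\pmb{A}_d-\pi_0\pmb{0}_0$, where $\pmb{A}_d=(A_d^k)_{k\ge0}$, $A_d$ is the Drazin inverse of $A$, and $\pi_0$ is the spectral projection of $A$ at $0$.
   Context: $\mathcal{C}_F$ is the $F$-algebra of all sequences over $F$ indexed by $k\ge0$, with componentwise operations; sequences of $q\times q$ matrices over $F$ are identified with elements of $M_q(\mathcal{C}_F)$; zeroth powers are identity matrices, and $\pmb{\Gamma}^i=(k^i)_{k\ge0}$ with $\pmb{\Gamma}^0=(1,1,1,\dots)$. For $\lambda\in F\setminus\{0\}$, $\pmb{\lambda}=(\lambda^k)_{k\ge0}$; $\mathcal{S}^{\ast}=\{\pmb{\lambda}:\lambda\in F,\lambda\ne0\}$; for $i\in\mathbb{N}$, $\pmb{0}_i$ is the sequence with $\pmb{0}_i(k)=\delta_{ik}$; $\mathcal{S}^{\circ}=\{\pmb{0}_i:i\ge0\}$. $F_{\mathcal{S}^{\ast}}$ and $F_{\mathcal{S}^{\circ}}$ are the $F$-spans of $\mathcal{S}^{\ast}$ (a basis of the first) and $\mathcal{S}^{\circ}$. For $A\in M_q(F)$ with characteristic polynomial split over $F$ ($\operatorname{char}F=0$),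 $(A^k)_{k\ge0}$ can be written uniquely (up to zero terms) as $\pmb{N}(A)+\pmb{\mathcal{A}}'_0\pmb{\Gamma}^0+\cdots+\pmb{\mathcal{A}}'_l\pmb{\Gamma}^l$ with $\pmb{N}(A)\in M_q(F_{\mathcal{S}^{\circ}})$ and $\pmb{\mathcal{A}}'_i\in M_q(F_{\mathcal{S}^{\ast}})$; this is the $\mathcal{P}$-canonical form of $A$ relative to $(\mathcal{S}^{\ast},\mathcal{H})$, and $\pmb{\mathcal{A}}'_0\pmb{\Gamma}^0+\cdots+\pmb{\mathcal{A}}'_l\pmb{\Gamma}^l$ is the geometric part of $A$ relative to $(\mathcal{S}^{\ast},\mathcal{H})$. Plugging $-k$ for $k$ in it means replacing each $(\lambda^k)_k$ occurring in the entries of the $\pmb{\mathcal{A}}'_i$ by $(\lambda^{-k})_k$ and each $\pmb{\Gamma}^i=(k^i)_k$ by $((-k)^i)_k$. $\pi_0$ is the projection onto the generalized eigenspace of $A$ at $0$ along the sum of the generalized eigenspaces at nonzero eigenvalues ($\pi_0=0$ if $A$ is nonsingular). The Drazin inverse $A_d$ is the unique matrix $B$ with $A^{k}BA=A^{k}$ for some $k\ge0$, $AB=BA$, $BAB=B$. *)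

theory Defs
  imports
    "Jordan_Normal_Form.Char_Poly"
    "HOL-Library.Function_Algebras"
begin

text \<open>
  The algebra of all sequences over \<open>F\<close> is the type \<open>nat \<Rightarrow> 'a\<close>. A matrix over this algebra is
  represented by the sequence of matrices that it is identified with, i.e. by a function
  \<open>nat \<Rightarrow> 'a mat\<close>; its entry at position \<open>(r, c)\<close> is the sequence \<open>\<lambda>k. M k $$ (r, c)\<close>.
\<close>

definition seq_scale :: "'a::field \<Rightarrow> (nat \<Rightarrow> 'a) \<Rightarrow> nat \<Rightarrow> 'a" where
  "seq_scale c s = (\<lambda>k. c * s k)"

interpretation seqs: vector_space seq_scale
  by unfold_locales (auto simp: seq_scale_def fun_eq_iff algebra_simps)

definition geom_seq :: "'a::field \<Rightarrow> nat \<Rightarrow> 'a" where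
  "geom_seq a = (\<lambda>k. a ^ k)"

definition zero_seq :: "nat \<Rightarrow> nat \<Rightarrow> 'a::field" where
  "zero_seq i = (\<lambda>k. if k = i then 1 else 0)"

definition S_star :: "(nat \<Rightarrow> 'a::field) set" where
  "S_star = {geom_seq a | a. a \<noteq> 0}"

lemma independent_S_star: "seqs.independent (S_star :: (nat \<Rightarrow> 'a::field) set)"
proof
  assume "seqs.dependent (S_star :: (nat \<Rightarrow> 'a) set)"
  then obtain t u v where t: "finite t" "t \<subseteq> (S_star :: (nat \<Rightarrow> 'a) set)"
    and z: "(\<Sum>s\<in>t. seq_scale (u s) s) = 0" and v: "v \<in> t" "u v \<noteq> 0"
    unfolding seqs.dependent_explicit by blast
  have pw: "s k = s 1 ^ k" if "s \<in> t" for s k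
    using that t(2) by (auto simp: S_star_def geom_seq_def)
  have z': "(\<Sum>s\<in>t. u s * s k) = 0" for k
  proof -
    have "(\<Sum>s\<in>t. seq_scale (u s) s) k = (\<Sum>s\<in>t. u s * s k)"
      using t(1) by (induction t rule: finite_induct) (auto simp: seq_scale_def)
    then show ?thesis using z by simp
  qed
  define p where "p = (\<Prod>s\<in>t - {v}. [:- s 1, 1:])"
  have "(\<Sum>s\<in>t. u s * poly p (s 1)) = (\<Sum>s\<in>t. \<Sum>k\<le>degree p. coeff p k * (u s * s k))"
    by (rule sum.cong[OF refl]) (simp add: poly_altdef sum_distrib_left pw[symmetric, simplified] mult_ac)
  also have "\<dots> = (\<Sum>k\<le>degree p. coeff p k * (\<Sum>s\<in>t. u s * s k))"
    by (subst sum.swap) (simp add: sum_distrib_left)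
  finally have "(\<Sum>s\<in>t. u s * poly p (s 1)) = 0" using z' by simp
  moreover have "poly p (s 1) = 0" if "s \<in> t - {v}" for s
    using that t(1) by (auto simp: p_def poly_prod prod_zero_iff)
  ultimately have "u v * poly p (v 1) = 0"
    using t(1) v(1) by (simp add: sum.remove)
  moreover have "poly p (v 1) \<noteq> 0"
  proof
    assume "poly p (v 1) = 0"
    then have "\<exists>s\<in>t - {v}. s 1 = v 1"
      using t(1) by (force simp: p_def poly_prod prod_zero_iff)
    then obtain s where s: "s \<in> t - {v}" "s 1 = v 1" by blast
    then have "s = v" using pw v(1) by (metis DiffD1 ext)
    then show False using s by simp
  qed
  ultimately show False using v(2) by simp
qed

definition S_circ :: "(nat \<Rightarrow> 'a::field) set" where
  "S_circ = range zero_seq"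

definition seq_mats :: "nat \<Rightarrow> (nat \<Rightarrow> 'a) set \<Rightarrow> (nat \<Rightarrow> 'a mat) set" where
  "seq_mats q R = {M. (\<forall>k. M k \<in> carrier_mat q q) \<and>
                      (\<forall>r<q. \<forall>c<q. (\<lambda>k. M k $$ (r, c)) \<in> R)}"

text \<open>
  With \<open>\<Gamma> = (0, 1, 2, \<dots>)\<close>, the \<open>k\<close>-th term of \<open>\<Gamma>\<^sup>i\<close> is \<open>of_nat k ^ i\<close>, where \<open>0 ^ 0 = 1\<close>.
  A polynomial \<open>\<A>\<^sub>0 \<Gamma>\<^sup>0 + \<dots> + \<A>\<^sub>l \<Gamma>\<^sup>l\<close> is given by the infinite family \<open>\<A>\<close> of its coefficients, almost
  all of which are zero. Thus the coefficient family does not record superfluous zero terms, and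
  the canonical form is unique, not only unique up to zero terms.
\<close>

definition nonzero_terms :: "nat \<Rightarrow> (nat \<Rightarrow> nat \<Rightarrow> 'a::field mat) \<Rightarrow> nat set" where
  "nonzero_terms q \<A> = {i. \<A> i \<noteq> (\<lambda>k. 0\<^sub>m q q)}"

definition poly_seq :: "nat \<Rightarrow> (nat \<Rightarrow> nat \<Rightarrow> 'a::field mat) \<Rightarrow> nat \<Rightarrow> 'a mat" where
  "poly_seq q \<A> = (\<lambda>k. mat q q (\<lambda>(r, c). \<Sum>i\<in>nonzero_terms q \<A>. \<A> i k $$ (r, c) * of_nat k ^ i))"

definition is_P_canonical_form ::
  "'a::field mat \<Rightarrow> (nat \<Rightarrow> 'a mat) \<Rightarrow> (nat \<Rightarrow> nat \<Rightarrow> 'a mat) \<Rightarrow> bool" where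
  "is_P_canonical_form A N \<A> \<longleftrightarrow>
     N \<in> seq_mats (dim_row A) (seqs.span S_circ) \<and>
     (\<forall>i. \<A> i \<in> seq_mats (dim_row A) (seqs.span S_star)) \<and>
     finite (nonzero_terms (dim_row A) \<A>) \<and>
     (\<forall>k. A ^\<^sub>m k = N k + poly_seq (dim_row A) \<A> k)"

definition P_canonical_form ::
  "'a::field mat \<Rightarrow> (nat \<Rightarrow> 'a mat) \<times> (nat \<Rightarrow> nat \<Rightarrow> 'a mat)" where
  "P_canonical_form A = (THE (N, \<A>). is_P_canonical_form A N \<A>)"

definition geometric_part :: "'a::field mat \<Rightarrow> nat \<Rightarrow> nat \<Rightarrow> 'a mat" where
  "geometric_part A = snd (P_canonical_form A)"

text \<open>
  \<open>plug_neg s\<close> replaces \<open>\<lambda>\<^sup>k\<close> by \<open>\<lambda>\<^sup>-\<^sup>k\<close> in the expansion of \<open>s\<close> in the basis \<open>S_star\<close>. The coordinate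
  of \<open>s\<close> at \<open>\<lambda>\<^sup>k\<close> is \<open>seqs.representation S_star s (geom_seq \<lambda>)\<close>; it is \<open>0\<close> for \<open>\<lambda> = 0\<close>, since
  \<open>geom_seq 0\<close> is not in \<open>S_star\<close>.
\<close>

definition plug_neg :: "(nat \<Rightarrow> 'a::field) \<Rightarrow> nat \<Rightarrow> 'a" where
  "plug_neg s = (\<lambda>k. \<Sum>a | seqs.representation S_star s (geom_seq a) \<noteq> 0.
                       seqs.representation S_star s (geom_seq a) * a powi (- int k))"

definition plug_neg_poly :: "nat \<Rightarrow> (nat \<Rightarrow> nat \<Rightarrow> 'a::field mat) \<Rightarrow> nat \<Rightarrow> 'a mat" where
  "plug_neg_poly q \<A> = (\<lambda>k. mat q q (\<lambda>(r, c).
     \<Sum>i\<in>nonzero_terms q \<A>. plug_neg (\<lambda>m. \<A> i m $$ (r, c)) k * (- of_nat k) ^ i))"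

definition is_drazin_inverse :: "'a::field mat \<Rightarrow> 'a mat \<Rightarrow> bool" where
  "is_drazin_inverse A B \<longleftrightarrow>
     B \<in> carrier_mat (dim_row A) (dim_row A) \<and>
     (\<exists>k. A ^\<^sub>m k * B * A = A ^\<^sub>m k) \<and> A * B = B * A \<and> B * A * B = B"

definition drazin_inverse :: "'a::field mat \<Rightarrow> 'a mat" where
  "drazin_inverse A = (THE B. is_drazin_inverse A B)"

definition gen_eigenspace :: "'a::field mat \<Rightarrow> 'a \<Rightarrow> 'a vec set" where
  "gen_eigenspace A a =
     {v \<in> carrier_vec (dim_row A). \<exists>m. ((A - a \<cdot>\<^sub>m 1\<^sub>m (dim_row A)) ^\<^sub>m m) *\<^sub>v v = 0\<^sub>v (dim_row A)}"

definition sum_nonzero_gen_eigenspaces :: "'a::field mat \<Rightarrow> 'a vec set" where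
  "sum_nonzero_gen_eigenspaces A =
     {finsum_vec TYPE('a) (dim_row A) w {a. eigenvalue A a \<and> a \<noteq> 0} | w.
        \<forall>a. eigenvalue A a \<and> a \<noteq> 0 \<longrightarrow> w a \<in> gen_eigenspace A a}"

text \<open>
  If \<open>A\<close> is nonsingular, \<open>gen_eigenspace A 0\<close> is trivial and the projection is the zero matrix.
\<close>

definition is_projection_along :: "nat \<Rightarrow> 'a::field vec set \<Rightarrow> 'a vec set \<Rightarrow> 'a mat \<Rightarrow> bool" where
  "is_projection_along q U W P \<longleftrightarrow> P \<in> carrier_mat q q \<and>
     (\<forall>u\<in>U. \<forall>w\<in>W. P *\<^sub>v (u + w) = u)"

definition spectral_projection_0 :: "'a::field mat \<Rightarrow> 'a mat" where
  "spectral_projection_0 A =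
     (THE P. is_projection_along (dim_row A) (gen_eigenspace A 0) (sum_nonzero_gen_eigenspaces A) P)"

end

theory Submission
  imports Defs
begin

text \<open>
  An exponential polynomial \<open>k \<mapsto> \<Sum>\<^sub>a a\<^sup>k p\<^sub>a(k)\<close> with bases \<open>a \<noteq> 0\<close> makes sense for all integers
  \<open>k\<close>, and in characteristic zero it is determined by its values at large \<open>k\<close>
  (\<open>exp_poly_eqI\<close>). Since the characteristic polynomial of \<open>A\<close> splits, the space is the sum of the
  generalized eigenspaces of \<open>A\<close> (\<open>gen_eigenspace_sum_UNIV\<close>), and therefore the entries of \<open>A\<^sup>k\<close>
  agree for large \<open>k\<close> with those of a sequence \<open>G\<close>, indexed by the integers, of matrices of
  exponential polynomials (\<open>exp_poly_mat_powers\<close>). By uniqueness, the geometric part of \<open>A\<close> is \<open>G\<close> on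
  the natural numbers, and plugging \<open>-k\<close> for \<open>k\<close> in it gives \<open>G (-k)\<close>
  (\<open>plug_neg_geometric_part\<close>).

  The identities \<open>A G(k) = G(k) A = G(k + 1)\<close> and \<open>G(k) G(l) = G(k + l)\<close> hold for large \<open>k\<close> and \<open>l\<close>,
  where \<open>G\<close> is given by powers of \<open>A\<close>, and so they hold for all integers. They show that \<open>G(-1)\<close> is
  the Drazin inverse of \<open>A\<close>, with \<open>k\<close>-th power \<open>G(-k)\<close> for \<open>k \<ge> 1\<close>. At \<open>k = 0\<close> the idempotent
  \<open>G(0)\<close> annihilates the generalized eigenspace at \<open>0\<close>, since \<open>G(0) = G(-m) A\<^sup>m\<close>, and it fixes all
  the others; thus \<open>1 - G(0)\<close> is the spectral projection at \<open>0\<close> (\<open>spectral_projection_0_eq\<close>), which is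
  the correction term of the statement.
\<close>

section \<open>Exponential polynomials on the integers\<close>

text \<open>
  An exponential polynomial is a function \<open>k \<mapsto> \<Sum>\<^sub>a a\<^sup>k p\<^sub>a(k)\<close> on all integers, where \<open>a\<close> ranges over
  finitely many nonzero field elements. It is given by the family of its polynomials \<open>p\<^sub>a\<close>, almost
  all of which are zero. The base \<open>0\<close> is excluded: \<open>0 powi k\<close> vanishes for all \<open>k \<noteq> 0\<close>, so such a
  term would not be determined by the values at large \<open>k\<close>.
\<close>

definition exp_coeffs :: "('a::field \<Rightarrow> 'a poly) \<Rightarrow> bool" where
  "exp_coeffs p \<longleftrightarrow> finite {a. p a \<noteq> 0} \<and> p 0 = 0"

definition exp_sum :: "('a::field \<Rightarrow> 'a poly) \<Rightarrow> int \<Rightarrow> 'a" where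
  "exp_sum p k = (\<Sum>a | p a \<noteq> 0. a powi k * poly (p a) (of_int k))"

definition exp_poly :: "(int \<Rightarrow> 'a::field) \<Rightarrow> bool" where
  "exp_poly f \<longleftrightarrow> (\<exists>p. exp_coeffs p \<and> f = exp_sum p)"

lemma exp_sum_superset:
  assumes "finite S" "{a. p a \<noteq> 0} \<subseteq> S"
  shows "exp_sum p k = (\<Sum>a\<in>S. a powi k * poly (p a) (of_int k))"
  unfolding exp_sum_def by (rule sum.mono_neutral_left) (use assms in auto)

lemma degree_forward_difference:
  fixes p :: "'a::idom poly"
  shows "pcompose p [:1, 1:] - p = 0 \<or> degree (pcompose p [:1, 1:] - p) < degree p"
proof (cases "degree p = 0")
  case True
  then obtain c where "p = [:c:]" by (rule degree_eq_zeroE)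
  then show ?thesis by simp
next
  case False
  let ?d = "pcompose p [:1, 1:] - p"
  have deg: "degree (pcompose p [:1, 1:]) = degree p" by simp
  have "degree ?d \<le> degree p" by (rule degree_diff_le) (simp_all add: deg)
  moreover have "coeff ?d (degree p) = 0"
    using lead_coeff_comp[of "[:1, 1::'a:]" p] by (simp add: deg)
  ultimately show ?thesis
    by (metis le_neq_implies_less leading_coeff_0_iff)
qed

lemma weighted_difference_nonzero:
  fixes p :: "'a::idom poly"
  assumes "Polynomial.smult a (pcompose p [:1, 1:]) - Polynomial.smult b p = 0" "a \<noteq> b"
  shows "p = 0"
proof -
  have "coeff (pcompose p [:1, 1:]) (degree p) = lead_coeff p"
    using lead_coeff_comp[of "[:1, 1::'a:]" p] by simp
  then have "(a - b) * lead_coeff p =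
      coeff (Polynomial.smult a (pcompose p [:1, 1:]) - Polynomial.smult b p) (degree p)"
    by (simp add: algebra_simps)
  with assms show ?thesis by simp
qed

text \<open>
  The functions \<open>k \<mapsto> a\<^sup>k k\<^sup>i\<close> with \<open>a \<noteq> 0\<close> are linearly independent, even if only their values at
  large \<open>k\<close> are taken into account.
\<close>

lemma exp_sum_tail_zero:
  fixes p :: "'a::field_char_0 \<Rightarrow> 'a poly"
  assumes "finite S" "0 \<notin> S"
    and "\<forall>\<^sub>F k in sequentially. (\<Sum>a\<in>S. a ^ k * poly (p a) (of_nat k)) = 0"
  shows "\<forall>a\<in>S. p a = 0"
  using assms
proof (induction S arbitrary: p rule: finite_induct)
  case empty
  then show ?case by simp
next
  case (insert b S)
  have b: "b \<noteq> 0" and S: "0 \<notin> S" using insert.prems by auto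
  let ?Z = "\<lambda>p :: 'a \<Rightarrow> 'a poly.
    \<forall>\<^sub>F k in sequentially. (\<Sum>a\<in>insert b S. a ^ k * poly (p a) (of_nat k)) = 0"
  have single: "p b = 0" if "?Z p" "\<forall>a\<in>S. p a = 0" for p
  proof -
    from that(1) have "\<forall>\<^sub>F k in sequentially. poly (p b) (of_nat k) = 0"
      by eventually_elim (use that(2) insert.hyps b in simp)
    then obtain K where "\<And>k. k \<ge> K \<Longrightarrow> poly (p b) (of_nat k) = 0"
      by (auto simp: eventually_sequentially)
    then have "of_nat ` {K..} \<subseteq> {x. poly (p b) x = 0}" by auto
    moreover have "infinite (of_nat ` {K..} :: 'a set)"
      by (subst finite_image_iff) (auto simp: inj_on_def infinite_Ici)
    ultimately have "infinite {x. poly (p b) x = 0}" by (meson infinite_super)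
    then show ?thesis using poly_roots_finite by blast
  qed
  have "?Z p \<Longrightarrow> \<forall>a\<in>insert b S. p a = 0" if "p b = 0 \<or> degree (p b) < n" for n p
    using that
  proof (induction n arbitrary: p)
    case 0
    then have "p b = 0" by simp
    then have "\<forall>\<^sub>F k in sequentially. (\<Sum>a\<in>S. a ^ k * poly (p a) (of_nat k)) = 0"
      using 0 insert.hyps by simp
    with insert.IH[OF S] \<open>p b = 0\<close> show ?case by simp
  next
    case (Suc n)
    \<comment> \<open>The operator \<open>f(k) \<mapsto> f(k + 1) - b f(k)\<close> lowers the degree of the \<open>b\<close>-coefficient
      and annihilates no nonzero coefficient at another base.\<close>
    define p' where "p' a = Polynomial.smult a (pcompose (p a) [:1, 1:]) - Polynomial.smult b (p a)" for a
    have eq: "(\<Sum>a\<in>insert b S. a ^ k * poly (p' a) (of_nat k)) =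
        (\<Sum>a\<in>insert b S. a ^ Suc k * poly (p a) (of_nat (Suc k))) -
        b * (\<Sum>a\<in>insert b S. a ^ k * poly (p a) (of_nat k))" for k
      unfolding p'_def sum_distrib_left sum_subtractf[symmetric]
      by (rule sum.cong) (auto simp: poly_pcompose algebra_simps)
    have "?Z p'"
    proof -
      have "\<forall>\<^sub>F k in sequentially.
          (\<Sum>a\<in>insert b S. a ^ Suc k * poly (p a) (of_nat (Suc k))) = 0"
        using Suc.prems(1)
          eventually_sequentially_Suc[of "\<lambda>k. (\<Sum>a\<in>insert b S. a ^ k * poly (p a) (of_nat k)) = 0"]
        by blast
      with Suc.prems(1) show ?thesis
        by eventually_elim (simp only: eq, simp)
    qed
    moreover have "p' b = 0 \<or> degree (p' b) < n"
    proof -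
      have p'b: "p' b = Polynomial.smult b (pcompose (p b) [:1, 1:] - p b)"
        by (simp add: p'_def smult_diff_right)
      show ?thesis
        using degree_forward_difference[of "p b"] Suc.prems(2) b unfolding p'b by auto
    qed
    ultimately have "\<forall>a\<in>insert b S. p' a = 0" using Suc.IH by blast
    then have "\<forall>a\<in>S. p a = 0"
      using insert.hyps weighted_difference_nonzero unfolding p'_def by blast
    with single Suc.prems(1) show ?case by blast
  qed
  from this[of p "Suc (degree (p b))"] insert.prems show ?case by auto
qed

lemma exp_sum_diff:
  assumes "exp_coeffs p" "exp_coeffs p'"
  shows "exp_coeffs (\<lambda>a. p a - p' a)"
    and "exp_sum (\<lambda>a. p a - p' a) k = exp_sum p k - exp_sum p' k"
proof -
  let ?S = "{a. p a \<noteq> 0} \<union> {a. p' a \<noteq> 0}"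
  have S: "finite ?S" using assms by (simp add: exp_coeffs_def)
  have sub: "{a. p a - p' a \<noteq> 0} \<subseteq> ?S" by auto
  show "exp_coeffs (\<lambda>a. p a - p' a)"
    using finite_subset[OF sub S] assms by (simp add: exp_coeffs_def)
  show "exp_sum (\<lambda>a. p a - p' a) k = exp_sum p k - exp_sum p' k"
    by (subst (1 2 3) exp_sum_superset[OF S])
      (auto simp: algebra_simps sum_subtractf)
qed

lemma exp_coeffs_unique:
  fixes p p' :: "'a::field_char_0 \<Rightarrow> 'a poly"
  assumes "exp_coeffs p" "exp_coeffs p'"
    and "\<forall>\<^sub>F k in sequentially. exp_sum p (int k) = exp_sum p' (int k)"
  shows "p = p'"
proof -
  define d where "d a = p a - p' a" for a
  have d: "exp_coeffs d" using exp_sum_diff(1)[OF assms(1,2)] by (simp add: d_def[abs_def])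
  have "\<forall>\<^sub>F k in sequentially. exp_sum d (int k) = 0"
    using assms(3) by eventually_elim
      (use exp_sum_diff(2)[OF assms(1,2)] in \<open>simp add: d_def[abs_def]\<close>)
  then have "\<forall>a\<in>{a. d a \<noteq> 0}. d a = 0"
    by (intro exp_sum_tail_zero) (use d in \<open>auto simp: exp_coeffs_def exp_sum_def\<close>)
  then show ?thesis by (auto simp: d_def fun_eq_iff)
qed

text \<open>
  The identity principle: an exponential polynomial on the integers is determined by its values at
  large positive arguments.
\<close>

lemma exp_poly_eqI:
  fixes f g :: "int \<Rightarrow> 'a::field_char_0"
  assumes "exp_poly f" "exp_poly g" "\<forall>\<^sub>F k in sequentially. f (int k) = g (int k)"
  shows "f = g"
  using assms exp_coeffs_unique unfolding exp_poly_def by blast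

lemma exp_polyI:
  assumes "finite S" "0 \<notin> S" "\<And>k. f k = (\<Sum>a\<in>S. a powi k * poly (p a) (of_int k))"
  shows "exp_poly f"
proof -
  let ?p = "\<lambda>a. if a \<in> S then p a else 0"
  have "exp_coeffs ?p" using assms(1,2) by (auto simp: exp_coeffs_def)
  moreover have "f = exp_sum ?p"
    by (rule ext, subst exp_sum_superset[OF assms(1)]) (auto simp: assms(3))
  ultimately show ?thesis unfolding exp_poly_def by blast
qed

lemma exp_poly_zero: "exp_poly (\<lambda>k. 0)"
  by (rule exp_polyI[of "{}"]) auto

lemma exp_poly_cmult:
  assumes "exp_poly f"
  shows "exp_poly (\<lambda>k. c * f k)"
proof -
  from assms obtain p where p: "exp_coeffs p" "f = exp_sum p" unfolding exp_poly_def by blast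
  show ?thesis
    by (rule exp_polyI[of "{a. p a \<noteq> 0}" _ "\<lambda>a. Polynomial.smult c (p a)"])
      (use p in \<open>auto simp: exp_coeffs_def exp_sum_def sum_distrib_left algebra_simps\<close>)
qed

lemma exp_poly_diff: "exp_poly f \<Longrightarrow> exp_poly g \<Longrightarrow> exp_poly (\<lambda>k. f k - g k)"
  using exp_sum_diff unfolding exp_poly_def fun_eq_iff by metis

lemma exp_poly_add: 
  assumes "exp_poly f" "exp_poly g" shows "exp_poly (\<lambda>k. f k + g k)"
  using exp_poly_diff[OF assms(1) exp_poly_cmult[OF assms(2), of "-1"]] by simp

lemma exp_poly_sum:
  assumes "\<And>i. i \<in> I \<Longrightarrow> exp_poly (f i)"
  shows "exp_poly (\<lambda>k. \<Sum>i\<in>I. f i k)"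
  using assms
  by (induction I rule: infinite_finite_induct) (auto intro: exp_poly_zero exp_poly_add)

lemma exp_poly_shift: 
  fixes f :: "int \<Rightarrow> 'a::field_char_0"
  assumes "exp_poly f" 
  shows "exp_poly (\<lambda>k. f (k + l))"
proof -
  from assms obtain p where p: "exp_coeffs p" "f = exp_sum p" unfolding exp_poly_def by blast
  show ?thesis
  proof (rule exp_polyI)
    show "finite {a. p a \<noteq> 0}" "0 \<notin> {a. p a \<noteq> 0}" using p by (auto simp: exp_coeffs_def)
    show "f (k + l) = (\<Sum>a | p a \<noteq> 0. a powi k *
        poly (Polynomial.smult (a powi l) (pcompose (p a) [:of_int l, 1:])) (of_int k))" for k
      unfolding p(2) exp_sum_def
    proof (rule sum.cong)
      fix a assume "a \<in> {a. p a \<noteq> 0}"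
      then have "a \<noteq> 0" using p(1) by (auto simp: exp_coeffs_def)
      then show "a powi (k + l) * poly (p a) (of_int (k + l)) = a powi k *
        poly (Polynomial.smult (a powi l) (pcompose (p a) [:of_int l, 1:])) (of_int k)"
        by (simp add: poly_pcompose power_int_add algebra_simps)
    qed simp
  qed
qed

section \<open>Indices and powers of matrices\<close>

lemma index_mult_mat_sum:
  assumes "M \<in> carrier_mat n m" "N \<in> carrier_mat m l" "i < n" "j < l"
  shows "(M * N) $$ (i, j) = (\<Sum>k<m. M $$ (i, k) * N $$ (k, j))"
  using assms by (simp add: scalar_prod_def lessThan_atLeast0)

lemma index_mult_mat_vec_sum:
  assumes "M \<in> carrier_mat n m" "v \<in> carrier_vec m" "i < n"
  shows "(M *\<^sub>v v) $ i = (\<Sum>k<m. M $$ (i, k) * v $ k)"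
  using assms by (auto simp: scalar_prod_def lessThan_atLeast0)

lemma index_mult_unit_vec:
  fixes M :: "'a::semiring_1 mat"
  assumes "M \<in> carrier_mat n m" "i < n" "j < m"
  shows "(M *\<^sub>v unit_vec m j) $ i = M $$ (i, j)"
proof -
  have "(M *\<^sub>v unit_vec m j) $ i = (\<Sum>k<m. if k = j then M $$ (i, k) else 0)"
    unfolding index_mult_mat_vec_sum[OF assms(1) unit_vec_carrier assms(2)]
    by (rule sum.cong) (use assms(3) in auto)
  then show ?thesis using assms(3) by simp
qed

lemma mult_mat_vec_zero [simp]:
  "M \<in> carrier_mat n m \<Longrightarrow> M *\<^sub>v 0\<^sub>v m = (0\<^sub>v n :: 'a::field vec)"
  by (auto intro!: eq_vecI)

lemma pow_mat_add:
  assumes A: "A \<in> carrier_mat n n"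
  shows "A ^\<^sub>m (k + l) = A ^\<^sub>m k * A ^\<^sub>m l"
proof (induction l)
  case (Suc l)
  then show ?case
    using assoc_mult_mat[OF pow_carrier_mat[OF A, of k] pow_carrier_mat[OF A, of l] A] by simp
qed (use A in simp)

lemma pow_mat_commute:
  assumes "A \<in> carrier_mat n n" "B \<in> carrier_mat n n" "A * B = B * A"
  shows "A ^\<^sub>m k * B = B * A ^\<^sub>m k"
proof (induction k)
  case (Suc k)
  have "A ^\<^sub>m Suc k * B = A ^\<^sub>m k * (A * B)"
    using assms by (simp add: assoc_mult_mat[of _ n n _ n _ n])
  also have "\<dots> = (A ^\<^sub>m k * B) * A"
    using assms by (simp add: assoc_mult_mat[of _ n n _ n _ n])
  also have "\<dots> = B * A ^\<^sub>m Suc k"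
    unfolding Suc using assms by (simp add: assoc_mult_mat[of _ n n _ n _ n])
  finally show ?case .
qed (use assms in simp)

lemma pow_mat_Suc_vec:
  assumes "A \<in> carrier_mat n n" "v \<in> carrier_vec n"
  shows "A ^\<^sub>m Suc k *\<^sub>v v = A ^\<^sub>m k *\<^sub>v (A *\<^sub>v v)"
    and "A ^\<^sub>m Suc k *\<^sub>v v = A *\<^sub>v (A ^\<^sub>m k *\<^sub>v v)"
proof -
  show "A ^\<^sub>m Suc k *\<^sub>v v = A ^\<^sub>m k *\<^sub>v (A *\<^sub>v v)"
    using assms by (simp add: assoc_mult_mat_vec[of _ n n _ n])
  have "A ^\<^sub>m Suc k = A * A ^\<^sub>m k" using pow_mat_commute[of A n A] assms by simp
  then show "A ^\<^sub>m Suc k *\<^sub>v v = A *\<^sub>v (A ^\<^sub>m k *\<^sub>v v)"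
    using assms by (simp add: assoc_mult_mat_vec[of _ n n _ n])
qed

section \<open>The Cayley-Hamilton theorem for sequences of entries\<close>

text \<open>
  The linear functional on polynomials that sends \<open>X\<^sup>k\<close> to \<open>s k\<close>. Multiplication of the polynomial
  by \<open>X\<close> corresponds to the shift of the sequence \<open>s\<close>.
\<close>

definition poly_functional :: "(nat \<Rightarrow> 'a::comm_ring_1) \<Rightarrow> 'a poly \<Rightarrow> 'a" where
  "poly_functional s p = (\<Sum>k\<le>degree p. coeff p k * s k)"

lemma poly_functional_superset:
  assumes "degree p \<le> n"
  shows "poly_functional s p = (\<Sum>k\<le>n. coeff p k * s k)"
  unfolding poly_functional_def
  by (rule sum.mono_neutral_left) (use assms in \<open>auto simp: coeff_eq_0\<close>)

lemma poly_functional_0 [simp]: "poly_functional s 0 = 0"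
  by (simp add: poly_functional_def)

lemma poly_functional_add: "poly_functional s (p + p') = poly_functional s p + poly_functional s p'"
  by (subst (1 2 3) poly_functional_superset[of _ "max (degree p) (degree p')"])
    (auto simp: degree_add_le algebra_simps sum.distrib)

lemma poly_functional_smult: "poly_functional s (Polynomial.smult c p) = c * poly_functional s p"
  by (subst (1 2) poly_functional_superset[of _ "degree p"])
    (auto simp: degree_smult_le sum_distrib_left algebra_simps)

lemma poly_functional_sum: "poly_functional s (\<Sum>i\<in>I. p i) = (\<Sum>i\<in>I. poly_functional s (p i))"
  by (induction I rule: infinite_finite_induct) (auto simp: poly_functional_add)

lemma poly_functional_pCons:
  "poly_functional s (pCons c p) = c * s 0 + poly_functional (\<lambda>k. s (Suc k)) p"
  by (subst poly_functional_superset[of _ "Suc (degree p)"])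
    (auto simp: degree_pCons_le poly_functional_def sum.atMost_Suc_shift simp del: sum.atMost_Suc)

lemma poly_functional_diff_seq:
  "poly_functional (\<lambda>k. s k - t k) p = poly_functional s p - poly_functional t p"
  by (simp add: poly_functional_def algebra_simps sum_subtractf)

lemma poly_functional_cmult_seq:
  "poly_functional (\<lambda>k. c * s k) p = c * poly_functional s p"
  by (simp add: poly_functional_def algebra_simps sum_distrib_left)

lemma poly_functional_sum_seq:
  "poly_functional (\<lambda>k. \<Sum>i\<in>I. s i k) p = (\<Sum>i\<in>I. poly_functional (s i) p)"
  unfolding poly_functional_def sum_distrib_left by (rule sum.swap)

lemma poly_functional_linear_factor:
  "poly_functional s ([:- a, 1:] * p) = poly_functional (\<lambda>k. s (Suc k) - a * s k) p"
  by (simp add: mult_pCons_left poly_functional_add poly_functional_smult poly_functional_pCons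
      poly_functional_diff_seq poly_functional_cmult_seq algebra_simps
      del: smult_minus_left)

text \<open>
  The Cayley-Hamilton theorem for the entries of the powers of \<open>A\<close>. With \<open>C = X - A\<close> and \<open>B\<close> its
  adjugate, \<open>C B = \<chi>\<close> is a scalar matrix, so \<open>\<chi>\<close> acting on the sequence of the \<open>(r, j)\<close>
  entries is a sum of contributions of the entries of \<open>C\<close>; these cancel because of
  \<open>A\<^sup>k\<^sup>+\<^sup>1 = A\<^sup>k A\<close>.
\<close>

lemma cayley_hamilton_entries:
  assumes A: "A \<in> carrier_mat q q" and r: "r < q" and j: "j < q"
  shows "poly_functional (\<lambda>k. (A ^\<^sub>m k) $$ (r, j)) (char_poly A) = 0"
proof -
  define s where "s i k = (A ^\<^sub>m k) $$ (r, i)" for i k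
  define C where "C = char_poly_matrix A"
  define B where "B = adj_mat C"
  have C: "C \<in> carrier_mat q q" using A by (simp add: C_def)
  have B: "B \<in> carrier_mat q q" using adj_mat(1)[OF C] by (simp add: B_def)
  have CB: "C * B = char_poly A \<cdot>\<^sub>m 1\<^sub>m q"
    using adj_mat(2)[OF C] by (simp add: B_def C_def char_poly_def)
  have Cil: "C $$ (i, l) = [:- A $$ (i, l), if i = l then 1 else 0:]" if "i < q" "l < q" for i l
    using that A by (auto simp: C_def char_poly_matrix_def)
  have entry: "poly_functional (s i) (C $$ (i, l) * p) =
      (if i = l then poly_functional (\<lambda>k. s l (Suc k)) p else 0) -
      A $$ (i, l) * poly_functional (s i) p" if "i < q" "l < q" for i l p
    using that
    by (simp add: Cil mult_pCons_left poly_functional_add poly_functional_smult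
      poly_functional_pCons algebra_simps del: smult_minus_left)
  have rec: "s l (Suc k) - (\<Sum>i<q. A $$ (i, l) * s i k) = 0" if "l < q" for l k
    using index_mult_mat_sum[OF pow_carrier_mat[OF A] A r that]
    by (simp add: s_def mult.commute)
  have "poly_functional (s j) (char_poly A) =
      (\<Sum>i<q. if i = j then poly_functional (s i) (char_poly A) else 0)"
    using j by simp
  also have "\<dots> = (\<Sum>i<q. poly_functional (s i) ((C * B) $$ (i, j)))"
    by (rule sum.cong) (use j in \<open>auto simp: CB\<close>)
  also have "\<dots> = (\<Sum>i<q. \<Sum>l<q. poly_functional (s i) (C $$ (i, l) * B $$ (l, j)))"
    by (rule sum.cong) (use j in \<open>auto simp: index_mult_mat_sum[OF C B] poly_functional_sum\<close>)
  also have "\<dots> = (\<Sum>l<q. \<Sum>i<q. poly_functional (s i) (C $$ (i, l) * B $$ (l, j)))"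
    by (rule sum.swap)
  also have "\<dots> = (\<Sum>l<q. poly_functional (\<lambda>k. s l (Suc k) - (\<Sum>i<q. A $$ (i, l) * s i k)) (B $$ (l, j)))"
    by (rule sum.cong)
      (auto simp: entry sum_subtractf poly_functional_diff_seq poly_functional_sum_seq
        poly_functional_cmult_seq)
  also have "\<dots> = 0" by (rule sum.neutral) (simp add: rec poly_functional_def)
  finally show ?thesis by (simp add: s_def[abs_def])
qed

lemma cayley_hamilton_vec:
  assumes A: "A \<in> carrier_mat q q" and v: "v \<in> carrier_vec q" and r: "r < q"
  shows "poly_functional (\<lambda>k. (A ^\<^sub>m k *\<^sub>v v) $ r) (char_poly A) = 0"
proof -
  have eq: "(A ^\<^sub>m k *\<^sub>v v) $ r = (\<Sum>j<q. v $ j * (A ^\<^sub>m k) $$ (r, j))" for k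
    using index_mult_mat_vec_sum[OF pow_carrier_mat[OF A] v r] by (simp add: mult.commute)
  show ?thesis
    unfolding eq poly_functional_sum_seq poly_functional_cmult_seq
    using cayley_hamilton_entries[OF A r] by simp
qed

section \<open>Decomposition into generalized eigenspaces\<close>

lemma gen_eigenspace_iff:
  assumes A: "A \<in> carrier_mat n n"
  shows "v \<in> gen_eigenspace A a \<longleftrightarrow>
    v \<in> carrier_vec n \<and> (\<exists>m. char_matrix A a ^\<^sub>m m *\<^sub>v v = 0\<^sub>v n)"
proof -
  have "A - a \<cdot>\<^sub>m 1\<^sub>m (dim_row A) = char_matrix A a"
    using A unfolding char_matrix_def by (intro eq_matI) auto
  then show ?thesis using A unfolding gen_eigenspace_def by auto
qed

lemma char_matrix_vec:
  assumes "A \<in> carrier_mat n n" "v \<in> carrier_vec n"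
  shows "char_matrix A a *\<^sub>v v = A *\<^sub>v v - a \<cdot>\<^sub>v v"
  using assms unfolding char_matrix_def
  by (intro eq_vecI) (auto simp: add_scalar_prod_distrib[of _ n])

lemma char_matrix_vec_carrier:
  "A \<in> carrier_mat n n \<Longrightarrow> v \<in> carrier_vec n \<Longrightarrow> char_matrix A a *\<^sub>v v \<in> carrier_vec n"
  by (rule mult_mat_vec_carrier[OF char_matrix_closed])

lemma gen_eigenspace_carrier: "A \<in> carrier_mat n n \<Longrightarrow> v \<in> gen_eigenspace A a \<Longrightarrow> v \<in> carrier_vec n"
  by (auto simp: gen_eigenspace_iff)

lemma zero_in_gen_eigenspace: "A \<in> carrier_mat n n \<Longrightarrow> 0\<^sub>v n \<in> gen_eigenspace A a"
  unfolding gen_eigenspace_iff by (auto intro!: exI[of _ 0])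

lemma gen_eigenspace_shift_iff:
  assumes A: "A \<in> carrier_mat n n" and v: "v \<in> carrier_vec n"
  shows "char_matrix A a *\<^sub>v v \<in> gen_eigenspace A a \<longleftrightarrow> v \<in> gen_eigenspace A a"
proof
  let ?T = "char_matrix A a"
  have T: "?T \<in> carrier_mat n n" using A by auto
  assume "?T *\<^sub>v v \<in> gen_eigenspace A a"
  then obtain m where "?T ^\<^sub>m m *\<^sub>v (?T *\<^sub>v v) = 0\<^sub>v n"
    unfolding gen_eigenspace_iff[OF A] by blast
  then have "?T ^\<^sub>m Suc m *\<^sub>v v = 0\<^sub>v n" using pow_mat_Suc_vec(1)[OF T v] by simp
  then show "v \<in> gen_eigenspace A a" using v unfolding gen_eigenspace_iff[OF A] by blast
next
  let ?T = "char_matrix A a"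
  have T: "?T \<in> carrier_mat n n" using A by auto
  assume "v \<in> gen_eigenspace A a"
  then obtain m where "?T ^\<^sub>m m *\<^sub>v v = 0\<^sub>v n" unfolding gen_eigenspace_iff[OF A] by blast
  then have "?T ^\<^sub>m m *\<^sub>v (?T *\<^sub>v v) = 0\<^sub>v n"
    using pow_mat_Suc_vec[OF T v] T by simp
  moreover have "?T *\<^sub>v v \<in> carrier_vec n" by (rule char_matrix_vec_carrier[OF A v])
  ultimately show "?T *\<^sub>v v \<in> gen_eigenspace A a" unfolding gen_eigenspace_iff[OF A] by blast
qed

text \<open>
  Induction along \<open>v, (A - a) v, (A - a)\<^sup>2 v, \<dots>\<close>, which reaches the zero vector after finitely many
  steps.
\<close>

lemma gen_eigenspace_induct [consumes 2, case_names zero shift]: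
  assumes A: "A \<in> carrier_mat n n" and v: "v \<in> gen_eigenspace A a"
    and zero: "P (0\<^sub>v n)"
    and shift: "\<And>v. v \<in> gen_eigenspace A a \<Longrightarrow> v \<in> carrier_vec n \<Longrightarrow>
      P (char_matrix A a *\<^sub>v v) \<Longrightarrow> P v"
  shows "P v"
proof -
  let ?T = "char_matrix A a"
  have T: "?T \<in> carrier_mat n n" using A by auto
  have "P v" if "v \<in> carrier_vec n" "?T ^\<^sub>m m *\<^sub>v v = 0\<^sub>v n" for m v
    using that
  proof (induction m arbitrary: v)
    case 0
    then show ?case using zero T A by simp
  next
    case (Suc m)
    have "v \<in> gen_eigenspace A a" using Suc.prems unfolding gen_eigenspace_iff[OF A] by blast
    moreover have "P (?T *\<^sub>v v)"
      by (rule Suc.IH) (use Suc.prems T pow_mat_Suc_vec(1)[OF T Suc.prems(1)] in auto)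
    ultimately show ?case using shift Suc.prems(1) by blast
  qed
  with v show ?thesis unfolding gen_eigenspace_iff[OF A] by blast
qed

lemma gen_eigenspace_smult:
  assumes A: "A \<in> carrier_mat n n" and "v \<in> gen_eigenspace A a"
  shows "c \<cdot>\<^sub>v v \<in> gen_eigenspace A a"
  using assms
proof (induction rule: gen_eigenspace_induct)
  case zero
  have "c \<cdot>\<^sub>v 0\<^sub>v n = (0\<^sub>v n :: 'a vec)" by auto
  then show ?case using zero_in_gen_eigenspace[OF A] by simp
next
  case (shift v)
  then have "char_matrix A a *\<^sub>v (c \<cdot>\<^sub>v v) \<in> gen_eigenspace A a"
    using mult_mat_vec[OF char_matrix_closed[OF A, of a]] by simp
  then show ?case using gen_eigenspace_shift_iff[OF A] shift(2) by (metis smult_carrier_vec)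
qed

lemma gen_eigenspace_add:
  assumes A: "A \<in> carrier_mat n n" and "v \<in> gen_eigenspace A a" and w: "w \<in> gen_eigenspace A a"
  shows "v + w \<in> gen_eigenspace A a"
  using assms
proof (induction arbitrary: w rule: gen_eigenspace_induct)
  case zero
  then show ?case using gen_eigenspace_carrier[OF A] by simp
next
  case (shift v)
  have w: "w \<in> carrier_vec n" using shift gen_eigenspace_carrier[OF A] by blast
  then have "char_matrix A a *\<^sub>v w \<in> gen_eigenspace A a"
    using gen_eigenspace_shift_iff[OF A] shift by blast
  then have "char_matrix A a *\<^sub>v v + char_matrix A a *\<^sub>v w \<in> gen_eigenspace A a"
    using shift by blast
  then have "char_matrix A a *\<^sub>v (v + w) \<in> gen_eigenspace A a"
    using mult_add_distrib_mat_vec[OF char_matrix_closed[OF A, of a]] shift w by simp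
  then show ?case using gen_eigenspace_shift_iff[OF A] shift w by (metis add_carrier_vec)
qed

lemma gen_eigenspace_diff:
  assumes A: "A \<in> carrier_mat n n" and "v \<in> gen_eigenspace A a" "w \<in> gen_eigenspace A a"
  shows "v - w \<in> gen_eigenspace A a"
proof -
  have "v - w = v + (-1) \<cdot>\<^sub>v w"
    using gen_eigenspace_carrier[OF A] assms(2,3) by (intro eq_vecI) fastforce+
  then show ?thesis using gen_eigenspace_add gen_eigenspace_smult assms by metis
qed

lemma gen_eigenspace_trivial:
  assumes A: "A \<in> carrier_mat n n" and "v \<in> gen_eigenspace A a" and "\<not> eigenvalue A a"
  shows "v = 0\<^sub>v n"
  using assms
proof (induction rule: gen_eigenspace_induct)
  case (shift v)
  then have "A *\<^sub>v v - a \<cdot>\<^sub>v v = 0\<^sub>v n" using char_matrix_vec[OF A] by auto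
  then have "A *\<^sub>v v = a \<cdot>\<^sub>v v"
    using A shift(2) by (auto simp: vec_eq_iff)
  then show ?case using shift A unfolding eigenvalue_def eigenvector_def by auto
qed simp

text \<open>
  For \<open>a \<noteq> b\<close>, the operator \<open>A - b = (A - a) + (a - b)\<close> is the sum of a nilpotent and a nonzero
  scalar operator on the generalized eigenspace at \<open>a\<close>, hence surjective there.
\<close>

lemma gen_eigenspace_shift_surj:
  assumes A: "A \<in> carrier_mat n n" and "w \<in> gen_eigenspace A a" and "a \<noteq> b"
  shows "\<exists>u\<in>gen_eigenspace A a. char_matrix A b *\<^sub>v u = w"
  using assms
proof (induction rule: gen_eigenspace_induct)
  case zero
  then show ?case using zero_in_gen_eigenspace[OF A] char_matrix_closed[OF A] by force
next
  case (shift w)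
  then obtain u where u: "u \<in> gen_eigenspace A a" "char_matrix A b *\<^sub>v u = char_matrix A a *\<^sub>v w"
    by blast
  let ?v = "inverse (a - b) \<cdot>\<^sub>v (w - u)"
  have uc: "u \<in> carrier_vec n" using u gen_eigenspace_carrier[OF A] by blast
  have "char_matrix A b *\<^sub>v (w - u) = char_matrix A b *\<^sub>v w - char_matrix A b *\<^sub>v u"
    using mult_minus_distrib_mat_vec[OF char_matrix_closed[OF A]] uc shift(2) by blast
  also have "\<dots> = (a - b) \<cdot>\<^sub>v w"
    unfolding u(2) char_matrix_vec[OF A shift(2)] using A shift(2)
    by (intro eq_vecI) (auto simp: algebra_simps)
  finally have "char_matrix A b *\<^sub>v ?v = inverse (a - b) \<cdot>\<^sub>v ((a - b) \<cdot>\<^sub>v w)"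
    using mult_mat_vec[OF char_matrix_closed[OF A]] uc shift(2) by (metis minus_carrier_vec)
  also have "\<dots> = w" using shift(4) by (simp add: smult_smult_assoc)
  finally show ?case using gen_eigenspace_smult[OF A] gen_eigenspace_diff[OF A] shift(1) u(1) by blast
qed

text \<open>
  The sum of all generalized eigenspaces, as the set of finite sums of their elements.
\<close>

inductive_set gen_eigenspace_sum :: "'a::field mat \<Rightarrow> 'a vec set" for A where
  zero: "0\<^sub>v (dim_row A) \<in> gen_eigenspace_sum A"
| add: "w \<in> gen_eigenspace A a \<Longrightarrow> v \<in> gen_eigenspace_sum A \<Longrightarrow> w + v \<in> gen_eigenspace_sum A"

lemma gen_eigenspace_sum_carrier:
  assumes "A \<in> carrier_mat n n" "v \<in> gen_eigenspace_sum A" shows "v \<in> carrier_vec n"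
  using assms(2) by induction (use assms(1) gen_eigenspace_carrier[OF assms(1)] in auto)

lemma gen_eigenspace_sum_shift_decomp:
  assumes A: "A \<in> carrier_mat n n" and "x \<in> gen_eigenspace_sum A"
  shows "\<exists>y\<in>gen_eigenspace_sum A. \<exists>z\<in>gen_eigenspace A b. x = char_matrix A b *\<^sub>v y + z"
  using assms(2)
proof induction
  case zero
  have "0\<^sub>v n = char_matrix A b *\<^sub>v 0\<^sub>v n + 0\<^sub>v n" by (simp add: mult_mat_vec_zero[OF char_matrix_closed[OF A]])
  moreover have "0\<^sub>v n \<in> gen_eigenspace_sum A" using gen_eigenspace_sum.zero[of A] A by simp
  ultimately show ?case using zero_in_gen_eigenspace[OF A] A by (metis carrier_matD(1))
next
  case (add w a x)
  then obtain y z where y: "y \<in> gen_eigenspace_sum A" and z: "z \<in> gen_eigenspace A b"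
    and x: "x = char_matrix A b *\<^sub>v y + z" by blast
  have c: "w \<in> carrier_vec n" "y \<in> carrier_vec n" "z \<in> carrier_vec n"
    "char_matrix A b *\<^sub>v y \<in> carrier_vec n"
    using add y z gen_eigenspace_carrier[OF A] gen_eigenspace_sum_carrier[OF A]
      char_matrix_vec_carrier[OF A] by blast+
  show ?case
  proof (cases "a = b")
    case True
    have "w + x = char_matrix A b *\<^sub>v y + (w + z)"
      unfolding x using c by (intro eq_vecI) auto
    then show ?thesis using y gen_eigenspace_add[OF A] z add True by blast
  next
    case False
    then obtain u where u: "u \<in> gen_eigenspace A a" "char_matrix A b *\<^sub>v u = w"
      using gen_eigenspace_shift_surj[OF A] add by blast
    have uc: "u \<in> carrier_vec n" using u gen_eigenspace_carrier[OF A] by blast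
    have "w + x = char_matrix A b *\<^sub>v (u + y) + z"
      unfolding x using c uc mult_add_distrib_mat_vec[OF char_matrix_closed[OF A] uc c(2)]
      by (simp add: u(2))
    then show ?thesis using gen_eigenspace_sum.add[OF u(1) y] z by blast
  qed
qed

lemma gen_eigenspace_sum_shift:
  assumes A: "A \<in> carrier_mat n n" and v: "v \<in> carrier_vec n"
    and "char_matrix A b *\<^sub>v v \<in> gen_eigenspace_sum A"
  shows "v \<in> gen_eigenspace_sum A"
proof -
  obtain y z where y: "y \<in> gen_eigenspace_sum A" and z: "z \<in> gen_eigenspace A b"
    and x: "char_matrix A b *\<^sub>v v = char_matrix A b *\<^sub>v y + z"
    using gen_eigenspace_sum_shift_decomp[OF A assms(3)] by blast
  have c: "y \<in> carrier_vec n" "z \<in> carrier_vec n" "char_matrix A b *\<^sub>v y \<in> carrier_vec n"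
    using y z gen_eigenspace_carrier[OF A] gen_eigenspace_sum_carrier[OF A]
      char_matrix_vec_carrier[OF A] by blast+
  have "w + z - w = z" if "w \<in> carrier_vec n" for w
    using that c(2) by (intro eq_vecI) auto
  then have "char_matrix A b *\<^sub>v (v - y) = z"
    using mult_minus_distrib_mat_vec[OF char_matrix_closed[OF A] v c(1)] x c(3) by metis
  then have "v - y \<in> gen_eigenspace A b"
    using gen_eigenspace_shift_iff[OF A] z v c by (metis minus_carrier_vec)
  moreover have "v = (v - y) + y" using v c by (intro eq_vecI) auto
  ultimately show ?thesis using gen_eigenspace_sum.add y by metis
qed

text \<open>
  If the characteristic polynomial \<open>\<Prod> (X - a\<^sub>i)\<close> splits, then \<open>\<Prod> (A - a\<^sub>i)\<close> maps every vector to
  zero. The factors are stripped off one at a time, since a vector belongs to the sum of the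
  generalized eigenspaces as soon as its image under some \<open>A - a\<^sub>i\<close> does.
\<close>

lemma gen_eigenspace_sum_UNIV:
  assumes A: "A \<in> carrier_mat n n" and split: "char_poly A = (\<Prod>a\<leftarrow>as. [:- a, 1:])"
    and v: "v \<in> carrier_vec n"
  shows "v \<in> gen_eigenspace_sum A"
proof -
  have "v \<in> gen_eigenspace_sum A"
    if "v \<in> carrier_vec n"
      "\<And>r. r < n \<Longrightarrow> poly_functional (\<lambda>k. (A ^\<^sub>m k *\<^sub>v v) $ r) (\<Prod>a\<leftarrow>as. [:- a, 1:]) = 0" for v
    using that
  proof (induction as arbitrary: v)
    case Nil
    have "v = 0\<^sub>v n" using Nil A by (intro eq_vecI) (auto simp: poly_functional_def)
    then show ?case using gen_eigenspace_sum.zero[of A] A by simp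
  next
    case (Cons a as)
    let ?w = "char_matrix A a *\<^sub>v v"
    have w: "?w \<in> carrier_vec n" using char_matrix_vec_carrier[OF A] Cons.prems(1) by blast
    have "(A ^\<^sub>m k *\<^sub>v ?w) $ r = (A ^\<^sub>m Suc k *\<^sub>v v) $ r - a * (A ^\<^sub>m k *\<^sub>v v) $ r" if "r < n" for r k
    proof -
      have "A ^\<^sub>m k *\<^sub>v ?w = A ^\<^sub>m k *\<^sub>v (A *\<^sub>v v) - a \<cdot>\<^sub>v (A ^\<^sub>m k *\<^sub>v v)"
        unfolding char_matrix_vec[OF A Cons.prems(1)]
        using A Cons.prems(1)
        by (simp add: mult_minus_distrib_mat_vec[of _ n n] mult_mat_vec[of _ n n])
      then show ?thesis
        using that A Cons.prems(1) by (simp add: pow_mat_Suc_vec(1)[OF A] del: pow_mat.simps)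
    qed
    then have "?w \<in> gen_eigenspace_sum A"
      using Cons.prems(2) w
      by (intro Cons.IH) (auto simp: poly_functional_linear_factor simp del: pow_mat.simps mult_pCons_left)
    then show ?case using gen_eigenspace_sum_shift[OF A Cons.prems(1)] by blast
  qed
  from this[OF v] cayley_hamilton_vec[OF A v] split show ?thesis by metis
qed

section \<open>Exponential polynomials for the powers of a matrix\<close>

lemma newton_forward_sum:
  fixes t :: "nat \<Rightarrow> 'a::comm_ring_1"
  assumes "\<And>k. t (Suc k) - t k = (\<Sum>j<m. c j * of_nat (k choose j))"
  shows "t k = t 0 + (\<Sum>j<m. c j * of_nat (k choose Suc j))"
proof (induction k)
  case (Suc k)
  have "t (Suc k) = t k + (\<Sum>j<m. c j * of_nat (k choose j))"
    using assms[of k] by (simp add: algebra_simps)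
  then show ?case using Suc by (simp add: algebra_simps sum.distrib)
qed simp

lemma binomial_eq_poly:
  "\<exists>p :: 'a::field_char_0 poly. \<forall>k. of_nat (k choose j) = poly p (of_nat k)"
proof (intro exI allI)
  fix k
  show "of_nat (k choose j) =
      poly (Polynomial.smult (inverse (fact j)) (\<Prod>i=0..<j. [:- of_nat i, 1:])) (of_nat k :: 'a)"
    by (simp add: binomial_gbinomial gbinomial_prod_rev poly_prod field_simps)
qed

text \<open>
  On the generalized eigenspace at \<open>a \<noteq> 0\<close>, the sequence of the \<open>r\<close>-th components of
  \<open>a\<^sup>-\<^sup>k A\<^sup>k v\<close> has as forward difference \<open>a\<^sup>-\<^sup>1\<close> times the corresponding sequence of
  \<open>(A - a) v\<close>. By Newton's formula it is a combination of the sequences \<open>k choose j\<close>.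
\<close>

lemma gen_eigenspace_powers:
  fixes A :: "'a::field mat"
  assumes A: "A \<in> carrier_mat n n" and "v \<in> gen_eigenspace A a" and a: "a \<noteq> 0" and r: "r < n"
  shows "\<exists>m c. \<forall>k. (A ^\<^sub>m k *\<^sub>v v) $ r = a ^ k * (\<Sum>j<m. c j * of_nat (k choose j))"
  using assms(1,2)
proof (induction rule: gen_eigenspace_induct)
  case zero
  have "A ^\<^sub>m k *\<^sub>v 0\<^sub>v n = 0\<^sub>v n" for k
    using A by (simp add: mult_mat_vec_zero[OF pow_carrier_mat[OF A]])
  then show ?case using r by (intro exI[of _ 0]) simp
next
  case (shift v)
  let ?w = "char_matrix A a *\<^sub>v v"
  obtain m c where mc: "\<And>k. (A ^\<^sub>m k *\<^sub>v ?w) $ r = a ^ k * (\<Sum>j<m. c j * of_nat (k choose j))"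
    using shift by blast
  define t where "t k = (A ^\<^sub>m k *\<^sub>v v) $ r / a ^ k" for k
  have "t (Suc k) - t k = (\<Sum>j<m. c j / a * of_nat (k choose j))" for k
  proof -
    have "A ^\<^sub>m k *\<^sub>v ?w = A ^\<^sub>m Suc k *\<^sub>v v - a \<cdot>\<^sub>v (A ^\<^sub>m k *\<^sub>v v)"
      unfolding char_matrix_vec[OF A shift(2)] pow_mat_Suc_vec(1)[OF A shift(2)]
      using A shift(2) by (simp add: mult_minus_distrib_mat_vec[of _ n n] mult_mat_vec[of _ n n])
    then have "a ^ k * (\<Sum>j<m. c j * of_nat (k choose j)) =
        (A ^\<^sub>m Suc k *\<^sub>v v) $ r - a * (A ^\<^sub>m k *\<^sub>v v) $ r"
      using mc[of k] r A shift(2) by (simp del: pow_mat.simps)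
    then have "t (Suc k) - t k = (\<Sum>j<m. c j * of_nat (k choose j)) / a"
      using a by (simp add: t_def diff_divide_distrib[symmetric] divide_eq_eq eq_divide_eq
          algebra_simps del: pow_mat.simps)
    then show ?thesis by (simp add: sum_divide_distrib)
  qed
  then have newton: "t k = t 0 + (\<Sum>j<m. c j / a * of_nat (k choose Suc j))" for k
    by (rule newton_forward_sum)
  have "t 0 + (\<Sum>j<m. c j / a * of_nat (k choose Suc j)) =
      (\<Sum>j<Suc m. (case j of 0 \<Rightarrow> t 0 | Suc i \<Rightarrow> c i / a) * of_nat (k choose j))" for k
    by (subst sum.lessThan_Suc_shift) simp
  with newton have "t k = (\<Sum>j<Suc m. (case j of 0 \<Rightarrow> t 0 | Suc i \<Rightarrow> c i / a) *
      of_nat (k choose j))" for k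
    by (rule trans)
  moreover have "(A ^\<^sub>m k *\<^sub>v v) $ r = a ^ k * t k" for k
    using a by (simp add: t_def)
  ultimately show ?case by metis
qed

lemma gen_eigenspace_zero_powers:
  assumes A: "A \<in> carrier_mat n n" and v: "v \<in> gen_eigenspace A 0"
  shows "\<forall>\<^sub>F k in sequentially. A ^\<^sub>m k *\<^sub>v v = 0\<^sub>v n"
proof -
  have "char_matrix A 0 = A" using A by (intro eq_matI) (auto simp: char_matrix_def)
  then obtain m where m: "A ^\<^sub>m m *\<^sub>v v = 0\<^sub>v n" and vc: "v \<in> carrier_vec n"
    using v unfolding gen_eigenspace_iff[OF A] by auto
  have "A ^\<^sub>m k *\<^sub>v v = 0\<^sub>v n" if "k \<ge> m" for k
  proof -
    have "A ^\<^sub>m k = A ^\<^sub>m (k - m) * A ^\<^sub>m m" using pow_mat_add[OF A, of "k - m" m] that by simp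
    then show ?thesis using m vc A mult_mat_vec_zero[OF pow_carrier_mat[OF A]]
      by (simp add: assoc_mult_mat_vec[of _ n n _ n])
  qed
  then show ?thesis unfolding eventually_sequentially by blast
qed

lemma gen_eigenspace_sum_powers:
  fixes A :: "'a::field_char_0 mat"
  assumes A: "A \<in> carrier_mat n n" and "v \<in> gen_eigenspace_sum A" and r: "r < n"
  shows "\<exists>f. exp_poly f \<and> (\<forall>\<^sub>F k in sequentially. (A ^\<^sub>m k *\<^sub>v v) $ r = f (int k))"
  using assms(2)
proof induction
  case zero
  have "A ^\<^sub>m k *\<^sub>v 0\<^sub>v n = 0\<^sub>v n" for k
    by (simp add: mult_mat_vec_zero[OF pow_carrier_mat[OF A]])
  then show ?case using r A by (intro exI[of _ "\<lambda>k. 0"]) (simp add: exp_poly_zero)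
next
  case (add w a v)
  have c: "w \<in> carrier_vec n" "v \<in> carrier_vec n"
    using add gen_eigenspace_carrier[OF A] gen_eigenspace_sum_carrier[OF A] by auto
  have "\<exists>f. exp_poly f \<and> (\<forall>\<^sub>F k in sequentially. (A ^\<^sub>m k *\<^sub>v w) $ r = f (int k))"
  proof (cases "a = 0")
    case True
    show ?thesis
    proof (intro exI conjI)
      show "\<forall>\<^sub>F k in sequentially. (A ^\<^sub>m k *\<^sub>v w) $ r = (\<lambda>k :: int. 0) (int k)"
        using gen_eigenspace_zero_powers[OF A add(1)[unfolded True]]
        by eventually_elim (simp add: r)
    qed (rule exp_poly_zero)
  next
    case False
    from gen_eigenspace_powers[OF A add(1) False r] obtain m c where
      mc: "\<And>k. (A ^\<^sub>m k *\<^sub>v w) $ r = a ^ k * (\<Sum>j<m. c j * of_nat (k choose j))" by blast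
    obtain b :: "nat \<Rightarrow> 'a poly" where b: "\<And>j k. of_nat (k choose j) = poly (b j) (of_nat k)"
      using binomial_eq_poly by metis
    let ?p = "\<Sum>j<m. Polynomial.smult (c j) (b j)"
    have "exp_poly (\<lambda>k. a powi k * poly ?p (of_int k))"
      by (rule exp_polyI[of "{a}" _ "\<lambda>_. ?p"]) (use False in auto)
    moreover have "(A ^\<^sub>m k *\<^sub>v w) $ r = a powi int k * poly ?p (of_int (int k))" for k
      by (simp add: mc b poly_sum)
    ultimately show ?thesis by (intro exI conjI) auto
  qed
  then obtain f g where f: "exp_poly f" "\<forall>\<^sub>F k in sequentially. (A ^\<^sub>m k *\<^sub>v w) $ r = f (int k)"
    and g: "exp_poly g" "\<forall>\<^sub>F k in sequentially. (A ^\<^sub>m k *\<^sub>v v) $ r = g (int k)"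
    using add.IH by blast
  show ?case
  proof (intro exI conjI)
    show "exp_poly (\<lambda>k. f k + g k)" using exp_poly_add f g by blast
    show "\<forall>\<^sub>F k in sequentially. (A ^\<^sub>m k *\<^sub>v (w + v)) $ r = f (int k) + g (int k)"
      using f(2) g(2) by eventually_elim
        (use r A c in \<open>simp add: mult_add_distrib_mat_vec[of _ n n]\<close>)
  qed
qed

text \<open>
  Sequences of \<open>n \<times> n\<close> matrices, indexed by all integers, whose entries are exponential polynomials.
\<close>

definition exp_poly_mat :: "nat \<Rightarrow> (int \<Rightarrow> 'a::field mat) \<Rightarrow> bool" where
  "exp_poly_mat n G \<longleftrightarrow> (\<forall>k. G k \<in> carrier_mat n n) \<and>
     (\<forall>r<n. \<forall>c<n. exp_poly (\<lambda>k. G k $$ (r, c)))"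

lemma exp_poly_mat_carrier: "exp_poly_mat n G \<Longrightarrow> G k \<in> carrier_mat n n"
  by (simp add: exp_poly_mat_def)

lemma exp_poly_mat_eqI:
  fixes G H :: "int \<Rightarrow> 'a::field_char_0 mat"
  assumes "exp_poly_mat n G" "exp_poly_mat n H"
    and ev: "\<forall>\<^sub>F k in sequentially. G (int k) = H (int k)"
  shows "G k = H k"
proof (rule eq_matI)
  fix r c assume "r < dim_row (H k)" "c < dim_col (H k)"
  then have rc: "r < n" "c < n" using exp_poly_mat_carrier[OF assms(2), of k] by auto
  have "(\<lambda>k. G k $$ (r, c)) = (\<lambda>k. H k $$ (r, c))"
    by (rule exp_poly_eqI)
      (use assms(1,2) rc ev in \<open>auto simp: exp_poly_mat_def elim: eventually_mono\<close>)
  then show "G k $$ (r, c) = H k $$ (r, c)" by metis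
qed (use exp_poly_mat_carrier[OF assms(1), of k] exp_poly_mat_carrier[OF assms(2), of k] in auto)

lemma exp_poly_mat_mult_left:
  assumes "exp_poly_mat n G" "M \<in> carrier_mat n n"
  shows "exp_poly_mat n (\<lambda>k. M * G k)"
proof -
  have "exp_poly (\<lambda>k. (M * G k) $$ (r, c))" if "r < n" "c < n" for r c
    unfolding index_mult_mat_sum[OF assms(2) exp_poly_mat_carrier[OF assms(1)] that]
    using assms(1) that by (intro exp_poly_sum exp_poly_cmult) (auto simp: exp_poly_mat_def)
  then show ?thesis
    using assms(2) exp_poly_mat_carrier[OF assms(1)] by (auto simp: exp_poly_mat_def intro: mult_carrier_mat)
qed

lemma exp_poly_mat_mult_right:
  assumes "exp_poly_mat n G" "M \<in> carrier_mat n n"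
  shows "exp_poly_mat n (\<lambda>k. G k * M)"
proof -
  have "exp_poly (\<lambda>k. (G k * M) $$ (r, c))" if "r < n" "c < n" for r c
    unfolding index_mult_mat_sum[OF exp_poly_mat_carrier[OF assms(1)] assms(2) that]
      mult.commute[of _ "M $$ _"]
    using assms(1) that by (intro exp_poly_sum exp_poly_cmult) (auto simp: exp_poly_mat_def)
  then show ?thesis
    using assms(2) exp_poly_mat_carrier[OF assms(1)] by (auto simp: exp_poly_mat_def intro: mult_carrier_mat)
qed

lemma exp_poly_mat_shift:
  fixes G :: "int \<Rightarrow> 'a::field_char_0 mat"
  assumes "exp_poly_mat n G"
  shows "exp_poly_mat n (\<lambda>k. G (k + l))"
  using assms exp_poly_shift[of "\<lambda>k. G k $$ _"] by (simp add: exp_poly_mat_def)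

text \<open>
  The powers of \<open>A\<close> eventually agree with an exponential polynomial \<open>G\<close>; this is the geometric part
  of \<open>A\<close>, extended to negative exponents.
\<close>

lemma exp_poly_mat_powers:
  fixes A :: "'a::field_char_0 mat"
  assumes A: "A \<in> carrier_mat n n" and split: "char_poly A = (\<Prod>a\<leftarrow>as. [:- a, 1:])"
  shows "\<exists>G. exp_poly_mat n G \<and> (\<forall>\<^sub>F k in sequentially. A ^\<^sub>m k = G (int k))"
proof -
  have "\<exists>f. exp_poly f \<and> (\<forall>\<^sub>F k in sequentially. (A ^\<^sub>m k) $$ (r, c) = f (int k))"
    if "r < n" "c < n" for r c
  proof -
    have "(A ^\<^sub>m k *\<^sub>v unit_vec n c) $ r = (A ^\<^sub>m k) $$ (r, c)" for k
      by (rule index_mult_unit_vec[OF pow_carrier_mat[OF A] that])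
    then show ?thesis
      using gen_eigenspace_sum_powers[OF A gen_eigenspace_sum_UNIV[OF A split] that(1),
          of "unit_vec n c"] by simp
  qed
  then obtain f where f: "\<And>r c. r < n \<Longrightarrow> c < n \<Longrightarrow> exp_poly (f r c)"
    "\<And>r c. r < n \<Longrightarrow> c < n \<Longrightarrow> \<forall>\<^sub>F k in sequentially. (A ^\<^sub>m k) $$ (r, c) = f r c (int k)"
    by metis
  define G where "G k = mat n n (\<lambda>(r, c). f r c k)" for k
  have "exp_poly_mat n G" using f(1) by (auto simp: exp_poly_mat_def G_def)
  moreover have "\<forall>\<^sub>F k in sequentially. \<forall>r\<in>{..<n}. \<forall>c\<in>{..<n}. (A ^\<^sub>m k) $$ (r, c) = f r c (int k)"
    by (intro eventually_ball_finite ballI) (use f(2) in auto)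
  then have "\<forall>\<^sub>F k in sequentially. A ^\<^sub>m k = G (int k)"
    by eventually_elim (use A in \<open>auto simp: G_def intro!: eq_matI\<close>)
  ultimately show ?thesis by blast
qed

section \<open>The Drazin inverse\<close>

text \<open>
  Throughout, \<open>G\<close> is an exponential polynomial that agrees with the powers of \<open>A\<close> at large exponents.
  Where \<open>G\<close> is given by powers of \<open>A\<close>, the identities \<open>mult_G\<close>, \<open>G_mult\<close> and \<open>G_mult_G\<close> are
  instances of the laws for powers; the identity principle extends them to all integers.
\<close>

context
  fixes A :: "'a::field_char_0 mat" and n :: nat and G :: "int \<Rightarrow> 'a mat"
  assumes A: "A \<in> carrier_mat n n" and G: "exp_poly_mat n G"
    and pow_eq: "\<forall>\<^sub>F k in sequentially. A ^\<^sub>m k = G (int k)"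
begin

lemma G_carrier: "G k \<in> carrier_mat n n"
  using exp_poly_mat_carrier[OF G] .

lemma pow_eq_Suc: "\<forall>\<^sub>F k in sequentially. A ^\<^sub>m Suc k = G (int k + 1)"
proof -
  have "\<forall>\<^sub>F k in sequentially. A ^\<^sub>m Suc k = G (int (Suc k))"
    by (rule iffD2[OF eventually_sequentially_Suc[of "\<lambda>k. A ^\<^sub>m k = G (int k)"] pow_eq])
  moreover have "int (Suc k) = int k + 1" for k by simp
  ultimately show ?thesis by (simp only:)
qed

lemma mult_G: "A * G k = G (k + 1)"
proof (rule exp_poly_mat_eqI[OF exp_poly_mat_mult_left[OF G A] exp_poly_mat_shift[OF G]])
  show "\<forall>\<^sub>F k in sequentially. A * G (int k) = G (int k + 1)"
    using pow_eq pow_eq_Suc by eventually_elim (metis pow_mat_commute[OF A A refl] pow_mat.simps(2))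
qed

lemma G_mult: "G k * A = G (k + 1)"
proof (rule exp_poly_mat_eqI[OF exp_poly_mat_mult_right[OF G A] exp_poly_mat_shift[OF G]])
  show "\<forall>\<^sub>F k in sequentially. G (int k) * A = G (int k + 1)"
    using pow_eq pow_eq_Suc by eventually_elim simp
qed

lemma G_mult_pow: "G k * A ^\<^sub>m m = G (int m + k)"
proof (induction m)
  case 0
  then show ?case using A right_mult_one_mat[OF G_carrier] by simp
next
  case (Suc m)
  have "G k * A ^\<^sub>m Suc m = G k * A ^\<^sub>m m * A"
    using assoc_mult_mat[OF G_carrier pow_carrier_mat[OF A] A] by simp
  then show ?case using Suc by (simp add: G_mult algebra_simps)
qed

lemma G_mult_G: "G k * G l = G (l + k)"
proof (rule exp_poly_mat_eqI[OF exp_poly_mat_mult_left[OF G G_carrier] exp_poly_mat_shift[OF G]])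
  show "\<forall>\<^sub>F l in sequentially. G k * G (int l) = G (int l + k)"
    using pow_eq by eventually_elim (use G_mult_pow in metis)
qed

lemma drazin_inverse_G: "is_drazin_inverse A (G (- 1))"
proof -
  obtain K where K: "A ^\<^sub>m K = G (int K)" using eventually_happens[OF pow_eq] by auto
  have "A ^\<^sub>m K * G (- 1) * A = A ^\<^sub>m K" by (simp add: K G_mult_G G_mult)
  moreover have "A * G (- 1) = G (- 1) * A" by (simp add: mult_G G_mult)
  moreover have "G (- 1) * A * G (- 1) = G (- 1)" by (simp add: G_mult G_mult_G)
  ultimately show ?thesis using A G_carrier unfolding is_drazin_inverse_def by auto
qed

text \<open>
  Any Drazin inverse \<open>B\<close> equals \<open>A\<^sup>m B\<^sup>m\<^sup>+\<^sup>1\<close>, so \<open>G 0\<close> fixes it; and \<open>G (-1)\<close> is a multiple of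
  \<open>A\<^sup>m\<close>, so it is fixed by \<open>B A\<close>. Therefore \<open>B = G 0 B = G (-1) A B = G (-1)\<close>.
\<close>

lemma drazin_inverse_unique:
  assumes "is_drazin_inverse A B"
  shows "B = G (- 1)"
proof -
  note assoc = assoc_mult_mat[of _ n n _ n _ n]
  from assms A obtain k where B: "B \<in> carrier_mat n n" and k: "A ^\<^sub>m k * B * A = A ^\<^sub>m k"
    and comm: "A * B = B * A" and BAB: "B * A * B = B"
    unfolding is_drazin_inverse_def by auto
  obtain K where K: "\<And>m. m \<ge> K \<Longrightarrow> A ^\<^sub>m m = G (int m)"
    using pow_eq unfolding eventually_sequentially by blast
  define m where "m = k + K"
  have Am: "A ^\<^sub>m m = G (int m)" using K by (simp add: m_def)
  have "A ^\<^sub>m m = A ^\<^sub>m K * A ^\<^sub>m k" using pow_mat_add[OF A, of K k] by (simp add: m_def add.commute)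
  then have AmF: "A ^\<^sub>m m * (B * A) = A ^\<^sub>m m"
    using k A B by (simp add: assoc)
  have "B ^\<^sub>m Suc j * A ^\<^sub>m j = B" for j
  proof (induction j)
    case (Suc j)
    define M where "M = B ^\<^sub>m Suc j"
    have M: "M \<in> carrier_mat n n" unfolding M_def by (rule pow_carrier_mat[OF B])
    have "B ^\<^sub>m Suc (Suc j) = B * M"
      using pow_mat_commute[OF B B refl, of "Suc j"] by (simp add: M_def)
    then have "B ^\<^sub>m Suc (Suc j) * A ^\<^sub>m Suc j = B * (M * A ^\<^sub>m j) * A"
      using A B M by (simp add: assoc del: pow_mat.simps(2)) (simp add: assoc)
    also have "M * A ^\<^sub>m j = B" using Suc by (simp add: M_def)
    also have "B * B * A = B * A * B" using A B comm by (simp add: assoc)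
    finally show ?case using BAB by simp
  qed (use A B in simp)
  then have Bm: "B = A ^\<^sub>m m * B ^\<^sub>m Suc m"
    using pow_mat_commute[OF A pow_carrier_mat[OF B, of "Suc m"], of m]
      pow_mat_commute[OF B A, of "Suc m"] comm by metis
  have "G 0 * B = G 0 * A ^\<^sub>m m * B ^\<^sub>m Suc m"
    by (subst Bm) (use A B G_carrier in \<open>simp add: assoc del: pow_mat.simps\<close>)
  also have "G 0 * A ^\<^sub>m m = A ^\<^sub>m m" using G_mult_pow[of 0 m] Am by simp
  also have "A ^\<^sub>m m * B ^\<^sub>m Suc m = B" by (rule Bm[symmetric])
  finally have "B = G (- 1) * A * B" by (simp add: G_mult)
  also have "\<dots> = G (- 1) * (B * A)"
    using assoc_mult_mat[OF G_carrier A B] comm by simp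
  also have "\<dots> = G (- int m - 1) * (A ^\<^sub>m m * (B * A))"
    using assoc_mult_mat[OF G_carrier pow_carrier_mat[OF A] mult_carrier_mat[OF B A],
        of "- int m - 1" m] G_mult_pow[of "- int m - 1" m] by simp
  also have "\<dots> = G (- 1)" unfolding AmF by (simp add: G_mult_pow)
  finally show ?thesis .
qed

lemma drazin_inverse_eq: "drazin_inverse A = G (- 1)"
  unfolding drazin_inverse_def
  by (rule the_equality, rule drazin_inverse_G, erule drazin_inverse_unique)

lemma drazin_inverse_pow: "drazin_inverse A ^\<^sub>m Suc k = G (- int (Suc k))"
proof (induction k)
  case 0
  then show ?case using left_mult_one_mat[OF G_carrier[of "- 1"]] G_carrier[of "- 1"]
    by (simp add: drazin_inverse_eq)
next
  case (Suc k)
  have "drazin_inverse A ^\<^sub>m Suc (Suc k) = G (- int (Suc k)) * G (- 1)"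
    using Suc by (simp add: drazin_inverse_eq)
  then show ?case by (simp add: G_mult_G)
qed

section \<open>The spectral projection at zero\<close>

text \<open>
  The defect \<open>u = w - G 0 w\<close> is annihilated by a power of \<open>A\<close>, since \<open>A\<^sup>m G 0 = A\<^sup>m\<close> for large \<open>m\<close>.
  By induction along the generalized eigenspace it is also annihilated by \<open>A - a\<close>; a nonzero such
  \<open>u\<close> would be an eigenvector at \<open>a \<noteq> 0\<close>, which no power of \<open>A\<close> annihilates.
\<close>

lemma G_0_fixes_gen_eigenspace:
  assumes "w \<in> gen_eigenspace A a" and a: "a \<noteq> 0"
  shows "G 0 *\<^sub>v w = w"
  using A assms(1)
proof (induction rule: gen_eigenspace_induct)
  case zero
  then show ?case by (simp add: mult_mat_vec_zero[OF G_carrier])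
next
  case (shift w)
  let ?T = "char_matrix A a"
  have w: "w \<in> carrier_vec n" by fact
  have Gw: "G 0 *\<^sub>v w \<in> carrier_vec n" by (rule mult_mat_vec_carrier[OF G_carrier w])
  have Aw: "A *\<^sub>v w \<in> carrier_vec n" by (rule mult_mat_vec_carrier[OF A w])
  define u where "u = w - G 0 *\<^sub>v w"
  have u: "u \<in> carrier_vec n" using w Gw by (simp add: u_def)
  have "?T *\<^sub>v (G 0 *\<^sub>v w) = G 0 *\<^sub>v (?T *\<^sub>v w)"
  proof -
    have "A *\<^sub>v (G 0 *\<^sub>v w) = G 0 *\<^sub>v (A *\<^sub>v w)"
      using assoc_mult_mat_vec[OF A G_carrier w, of 0] assoc_mult_mat_vec[OF G_carrier A w, of 0]
      by (simp add: mult_G G_mult)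
    moreover have "G 0 *\<^sub>v (A *\<^sub>v w - a \<cdot>\<^sub>v w) = G 0 *\<^sub>v (A *\<^sub>v w) - a \<cdot>\<^sub>v (G 0 *\<^sub>v w)"
      using mult_minus_distrib_mat_vec[OF G_carrier Aw, of "a \<cdot>\<^sub>v w" 0]
        mult_mat_vec[OF G_carrier w, of 0 a] w by simp
    ultimately show ?thesis
      unfolding char_matrix_vec[OF A w] char_matrix_vec[OF A Gw] by simp
  qed
  then have "?T *\<^sub>v u = ?T *\<^sub>v w - ?T *\<^sub>v w"
    unfolding u_def using mult_minus_distrib_mat_vec[OF char_matrix_closed[OF A, of a] w Gw] shift(3)
    by simp
  then have Tu: "?T *\<^sub>v u = 0\<^sub>v n" using char_matrix_vec_carrier[OF A w] by simp
  obtain m where m: "A ^\<^sub>m m = G (int m)" using eventually_happens[OF pow_eq] by auto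
  have "A ^\<^sub>m m *\<^sub>v (G 0 *\<^sub>v w) = A ^\<^sub>m m *\<^sub>v w"
    using assoc_mult_mat_vec[OF pow_carrier_mat[OF A] G_carrier w, of m 0]
    by (simp add: m G_mult_G)
  then have "A ^\<^sub>m m *\<^sub>v u = A ^\<^sub>m m *\<^sub>v w - A ^\<^sub>m m *\<^sub>v w"
    unfolding u_def using mult_minus_distrib_mat_vec[OF pow_carrier_mat[OF A, of m] w Gw] by simp
  then have Amu: "A ^\<^sub>m m *\<^sub>v u = 0\<^sub>v n"
    using mult_mat_vec_carrier[OF pow_carrier_mat[OF A] w, of m] by simp
  have "u = 0\<^sub>v n"
  proof (rule ccontr)
    assume "u \<noteq> 0\<^sub>v n"
    then have "eigenvector A u a" using eigenvector_char_matrix[OF A] u Tu by blast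
    then have "a ^ m \<cdot>\<^sub>v u = 0\<^sub>v n" using eigenvector_pow[OF A] Amu by metis
    then have "inverse (a ^ m) \<cdot>\<^sub>v (a ^ m \<cdot>\<^sub>v u) = inverse (a ^ m) \<cdot>\<^sub>v 0\<^sub>v n" by simp
    also have "inverse (a ^ m) \<cdot>\<^sub>v 0\<^sub>v n = 0\<^sub>v n" by (intro eq_vecI) auto
    finally have "u = 0\<^sub>v n" using a by (simp add: smult_smult_assoc)
    with \<open>u \<noteq> 0\<^sub>v n\<close> show False by simp
  qed
  moreover have "u + G 0 *\<^sub>v w = w" unfolding u_def using w Gw carrier_matD[OF G_carrier] by (intro eq_vecI) auto
  ultimately show ?case using left_zero_vec[OF Gw] by simp
qed

lemma finite_eigenvalues: "finite {a. eigenvalue A a \<and> a \<noteq> 0}"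
proof -
  have "char_poly A \<noteq> 0" using degree_monic_char_poly[OF A] by auto
  then have "finite {a. poly (char_poly A) a = 0}" by (rule poly_roots_finite)
  then show ?thesis
    by (rule finite_subset[rotated]) (auto simp: eigenvalue_root_char_poly[OF A])
qed

lemma sum_nonzero_index:
  assumes "\<forall>a. eigenvalue A a \<and> a \<noteq> 0 \<longrightarrow> w a \<in> gen_eigenspace A a"
  shows "finsum_vec TYPE('a) n w {a. eigenvalue A a \<and> a \<noteq> 0} \<in> carrier_vec n"
    and "i < n \<Longrightarrow> finsum_vec TYPE('a) n w {a. eigenvalue A a \<and> a \<noteq> 0} $ i =
      (\<Sum>a | eigenvalue A a \<and> a \<noteq> 0. w a $ i)"
proof -
  have "w \<in> {a. eigenvalue A a \<and> a \<noteq> 0} \<rightarrow> carrier_vec n"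
    using assms gen_eigenspace_carrier[OF A] by auto
  then show "finsum_vec TYPE('a) n w {a. eigenvalue A a \<and> a \<noteq> 0} \<in> carrier_vec n"
    "i < n \<Longrightarrow> finsum_vec TYPE('a) n w {a. eigenvalue A a \<and> a \<noteq> 0} $ i =
      (\<Sum>a | eigenvalue A a \<and> a \<noteq> 0. w a $ i)"
    using finsum_vec_closed index_finsum_vec[OF finite_eigenvalues] by blast+
qed

lemma sum_nonzeroE:
  assumes "x \<in> sum_nonzero_gen_eigenspaces A"
  obtains w where "\<forall>a. eigenvalue A a \<and> a \<noteq> 0 \<longrightarrow> w a \<in> gen_eigenspace A a"
    "x \<in> carrier_vec n" "\<And>i. i < n \<Longrightarrow> x $ i = (\<Sum>a | eigenvalue A a \<and> a \<noteq> 0. w a $ i)"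
proof -
  from assms A obtain w where w: "\<forall>a. eigenvalue A a \<and> a \<noteq> 0 \<longrightarrow> w a \<in> gen_eigenspace A a"
    and x: "x = finsum_vec TYPE('a) n w {a. eigenvalue A a \<and> a \<noteq> 0}"
    unfolding sum_nonzero_gen_eigenspaces_def by auto
  show thesis using that[OF w] sum_nonzero_index[OF w] unfolding x by blast
qed

lemma sum_nonzeroI:
  assumes w: "\<forall>a. eigenvalue A a \<and> a \<noteq> 0 \<longrightarrow> w a \<in> gen_eigenspace A a"
    and "x \<in> carrier_vec n" "\<And>i. i < n \<Longrightarrow> x $ i = (\<Sum>a | eigenvalue A a \<and> a \<noteq> 0. w a $ i)"
  shows "x \<in> sum_nonzero_gen_eigenspaces A"
proof -
  have "x = finsum_vec TYPE('a) n w {a. eigenvalue A a \<and> a \<noteq> 0}"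
    using sum_nonzero_index[OF w] assms(2,3) by (intro eq_vecI) auto
  then show ?thesis using w A unfolding sum_nonzero_gen_eigenspaces_def by auto
qed

lemma G_0_fixes_sum_nonzero:
  assumes "x \<in> sum_nonzero_gen_eigenspaces A"
  shows "G 0 *\<^sub>v x = x"
proof (rule eq_vecI)
  let ?S = "{a. eigenvalue A a \<and> a \<noteq> 0}"
  obtain w where w: "\<forall>a. eigenvalue A a \<and> a \<noteq> 0 \<longrightarrow> w a \<in> gen_eigenspace A a"
    and x: "x \<in> carrier_vec n" "\<And>i. i < n \<Longrightarrow> x $ i = (\<Sum>a\<in>?S. w a $ i)"
    using sum_nonzeroE[OF assms] by metis
  show "dim_vec (G 0 *\<^sub>v x) = dim_vec x" using x G_carrier[of 0] by simp
  fix i assume "i < dim_vec x"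
  then have i: "i < n" using x by simp
  have "(G 0 *\<^sub>v x) $ i = (\<Sum>k<n. \<Sum>a\<in>?S. G 0 $$ (i, k) * w a $ k)"
    by (simp add: index_mult_mat_vec_sum[OF G_carrier x(1) i] x(2) sum_distrib_left)
  also have "\<dots> = (\<Sum>a\<in>?S. \<Sum>k<n. G 0 $$ (i, k) * w a $ k)" by (rule sum.swap)
  also have "\<dots> = (\<Sum>a\<in>?S. (G 0 *\<^sub>v w a) $ i)"
    using w gen_eigenspace_carrier[OF A]
    by (intro sum.cong) (auto simp: index_mult_mat_vec_sum[OF G_carrier _ i])
  also have "\<dots> = x $ i"
    unfolding x(2)[OF i] using w by (intro sum.cong) (auto simp: G_0_fixes_gen_eigenspace)
  finally show "(G 0 *\<^sub>v x) $ i = x $ i" .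
qed

lemma gen_eigenspace_sum_split:
  assumes "v \<in> gen_eigenspace_sum A"
  shows "\<exists>u\<in>gen_eigenspace A 0. \<exists>x\<in>sum_nonzero_gen_eigenspaces A. v = u + x"
  using assms
proof induction
  case zero
  have "0\<^sub>v n \<in> sum_nonzero_gen_eigenspaces A"
    by (rule sum_nonzeroI[of "\<lambda>_. 0\<^sub>v n"]) (auto simp: zero_in_gen_eigenspace[OF A])
  then show ?case using zero_in_gen_eigenspace[OF A, of 0] A
    by (intro bexI[of _ "0\<^sub>v n"]) auto
next
  case (add w a v)
  let ?S = "{a. eigenvalue A a \<and> a \<noteq> 0}"
  from add obtain u x where u: "u \<in> gen_eigenspace A 0" and v: "v = u + x"
    and xs: "x \<in> sum_nonzero_gen_eigenspaces A" by blast
  obtain ws where ws: "\<forall>a. eigenvalue A a \<and> a \<noteq> 0 \<longrightarrow> ws a \<in> gen_eigenspace A a"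
    and x: "x \<in> carrier_vec n" "\<And>i. i < n \<Longrightarrow> x $ i = (\<Sum>a\<in>?S. ws a $ i)"
    using sum_nonzeroE[OF xs] by metis
  have c: "w \<in> carrier_vec n" "u \<in> carrier_vec n"
    using add(1) u gen_eigenspace_carrier[OF A] by auto
  show ?case
  proof (cases "a \<in> ?S")
    case True
    have wsa: "ws a \<in> carrier_vec n" using True ws gen_eigenspace_carrier[OF A] by blast
    have "w + x \<in> sum_nonzero_gen_eigenspaces A"
    proof (rule sum_nonzeroI[of "ws(a := w + ws a)"])
      show "\<forall>b. eigenvalue A b \<and> b \<noteq> 0 \<longrightarrow> (ws(a := w + ws a)) b \<in> gen_eigenspace A b"
        using ws gen_eigenspace_add[OF A add(1)] True by auto
      fix i assume i: "i < n"
      have "(\<Sum>b\<in>?S. (ws(a := w + ws a)) b $ i) = (w + ws a) $ i + (\<Sum>b\<in>?S - {a}. ws b $ i)"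
        by (subst sum.remove[OF finite_eigenvalues True]) simp
      also have "\<dots> = w $ i + (\<Sum>b\<in>?S. ws b $ i)"
        using i c wsa sum.remove[OF finite_eigenvalues True, of "\<lambda>b. ws b $ i"] by (simp add: add.assoc)
      finally show "(w + x) $ i = (\<Sum>b\<in>?S. (ws(a := w + ws a)) b $ i)"
        using i c x by simp
    qed (use c x in simp)
    moreover have "w + v = u + (w + x)" unfolding v using c x(1) by (intro eq_vecI) auto
    ultimately show ?thesis using u by blast
  next
    case False
    have "w \<in> gen_eigenspace A 0"
    proof (cases "a = 0")
      case False
      with \<open>a \<notin> ?S\<close> have "w = 0\<^sub>v n" using gen_eigenspace_trivial[OF A add(1)] by simp
      then show ?thesis using zero_in_gen_eigenspace[OF A] by simp
    qed (use add(1) in simp)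
    then have "w + u \<in> gen_eigenspace A 0" using gen_eigenspace_add[OF A] u by blast
    moreover have "w + v = (w + u) + x" unfolding v using c x(1) by (intro eq_vecI) auto
    ultimately show ?thesis using xs by blast
  qed
qed

lemma G_0_annihilates:
  assumes "u \<in> gen_eigenspace A 0"
  shows "G 0 *\<^sub>v u = 0\<^sub>v n"
proof -
  obtain m where m: "A ^\<^sub>m m *\<^sub>v u = 0\<^sub>v n"
    using eventually_happens[OF gen_eigenspace_zero_powers[OF A assms]] by auto
  have u: "u \<in> carrier_vec n" using gen_eigenspace_carrier[OF A assms] .
  have "G 0 *\<^sub>v u = (G (- int m) * A ^\<^sub>m m) *\<^sub>v u" by (simp add: G_mult_pow)
  also have "\<dots> = 0\<^sub>v n"
    unfolding assoc_mult_mat_vec[OF G_carrier pow_carrier_mat[OF A] u] m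
    by (rule mult_mat_vec_zero[OF G_carrier])
  finally show ?thesis .
qed

lemma spectral_projection_0_eq:
  assumes split: "char_poly A = (\<Prod>a\<leftarrow>as. [:- a, 1:])"
  shows "spectral_projection_0 A = 1\<^sub>m n - G 0"
proof -
  let ?U = "gen_eigenspace A 0" and ?W = "sum_nonzero_gen_eigenspaces A"
  have dim: "dim_row A = n" using A by simp
  have P: "1\<^sub>m n - G 0 \<in> carrier_mat n n" by (rule minus_carrier_mat[OF G_carrier])
  have proj: "(1\<^sub>m n - G 0) *\<^sub>v (u + x) = u" if "u \<in> ?U" "x \<in> ?W" for u x
  proof -
    have u: "u \<in> carrier_vec n" using gen_eigenspace_carrier[OF A that(1)] .
    have x: "x \<in> carrier_vec n" using sum_nonzeroE[OF that(2)] by metis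
    have "(1\<^sub>m n - G 0) *\<^sub>v (u + x) = (u + x) - (G 0 *\<^sub>v u + G 0 *\<^sub>v x)"
      using u x minus_mult_distrib_mat_vec[OF one_carrier_mat G_carrier add_carrier_vec[OF u x]]
        mult_add_distrib_mat_vec[OF G_carrier u x] by simp
    also have "\<dots> = u"
      unfolding G_0_annihilates[OF that(1)] G_0_fixes_sum_nonzero[OF that(2)]
      using u x by (intro eq_vecI) auto
    finally show ?thesis .
  qed
  show ?thesis
    unfolding spectral_projection_0_def dim
  proof (rule the_equality)
    show "is_projection_along n ?U ?W (1\<^sub>m n - G 0)"
      using proj P unfolding is_projection_along_def by blast
  next
    fix Q assume "is_projection_along n ?U ?W Q"
    then have Q: "Q \<in> carrier_mat n n" and Qp: "\<And>u x. u \<in> ?U \<Longrightarrow> x \<in> ?W \<Longrightarrow> Q *\<^sub>v (u + x) = u"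
      unfolding is_projection_along_def by auto
    have eq: "Q *\<^sub>v v = (1\<^sub>m n - G 0) *\<^sub>v v" if "v \<in> carrier_vec n" for v
      using gen_eigenspace_sum_split[OF gen_eigenspace_sum_UNIV[OF A split that]] Qp proj by force
    show "Q = 1\<^sub>m n - G 0"
    proof (rule eq_matI)
      fix i j assume "i < dim_row (1\<^sub>m n - G 0)" "j < dim_col (1\<^sub>m n - G 0)"
      then have ij: "i < n" "j < n" using P by auto
      have unit: "(M *\<^sub>v unit_vec n j) $ i = M $$ (i, j)" if "M \<in> carrier_mat n n"
        for M :: "'a mat"
        by (rule index_mult_unit_vec[OF that ij])
      show "Q $$ (i, j) = (1\<^sub>m n - G 0) $$ (i, j)"
        using unit[OF Q] unit[OF P] eq[of "unit_vec n j"] by simp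
    qed (use Q P in auto)
  qed
qed

end

section \<open>Coordinates of sequences\<close>

lemma geom_seq_inj: "inj geom_seq"
proof (rule injI)
  fix a b :: 'a
  assume "geom_seq a = geom_seq b"
  then have "geom_seq a 1 = geom_seq b 1" by simp
  then show "a = b" by (simp add: geom_seq_def)
qed

lemma sum_seq_apply: "(\<Sum>i\<in>I. f i) k = (\<Sum>i\<in>I. f i (k :: nat) :: 'a::comm_monoid_add)"
  by (induction I rule: infinite_finite_induct) auto

text \<open>
  The coordinate of \<open>s\<close> at \<open>(a\<^sup>k)\<^sub>k\<close> in the basis \<open>S_star\<close>; it is zero for \<open>a = 0\<close>, and for every
  sequence outside the span.
\<close>

definition geom_coord :: "(nat \<Rightarrow> 'a::field) \<Rightarrow> 'a \<Rightarrow> 'a" where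
  "geom_coord s a = seqs.representation S_star s (geom_seq a)"

lemma geom_coord_0 [simp]: "geom_coord s 0 = 0"
proof -
  have "geom_seq 0 \<notin> (S_star :: (nat \<Rightarrow> 'a) set)"
    using inj_eq[OF geom_seq_inj, of 0] by (auto simp: S_star_def)
  then show ?thesis
    unfolding geom_coord_def using seqs.representation_ne_zero by blast
qed

lemma geom_coord_zero_seq [simp]: "geom_coord (\<lambda>k. 0) a = 0"
  by (simp add: geom_coord_def seqs.representation_zero[unfolded zero_fun_def])

lemma finite_geom_coord: "finite {a. geom_coord s a \<noteq> 0}"
proof -
  have "finite (geom_seq -` {b. seqs.representation S_star s b \<noteq> 0})"
    by (rule finite_vimageI[OF seqs.finite_representation geom_seq_inj])
  then show ?thesis by (simp add: geom_coord_def vimage_def)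
qed

lemma geom_coord_expansion:
  assumes s: "s \<in> seqs.span S_star"
  shows "s k = (\<Sum>a | geom_coord s a \<noteq> 0. geom_coord s a * a ^ k)"
proof -
  let ?R = "seqs.representation S_star s"
  have "{b. ?R b \<noteq> 0} = geom_seq ` {a. geom_coord s a \<noteq> 0}"
    using seqs.representation_ne_zero[of S_star s] by (auto simp: geom_coord_def S_star_def)
  then have "(\<Sum>b | ?R b \<noteq> 0. seq_scale (?R b) b) =
      (\<Sum>a | geom_coord s a \<noteq> 0. seq_scale (geom_coord s a) (geom_seq a))"
    by (simp add: sum.reindex[OF inj_on_subset[OF geom_seq_inj]] geom_coord_def)
  then have "s = (\<Sum>a | geom_coord s a \<noteq> 0. seq_scale (geom_coord s a) (geom_seq a))"
    using seqs.sum_nonzero_representation_eq[OF independent_S_star s] by simp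
  from arg_cong[OF this, of "\<lambda>s. s k"] show ?thesis
    by (simp add: sum_seq_apply seq_scale_def geom_seq_def)
qed

lemma plug_neg_eq: "plug_neg s k = (\<Sum>a | geom_coord s a \<noteq> 0. geom_coord s a * a powi (- int k))"
  by (simp add: plug_neg_def geom_coord_def)

lemma span_S_circ_iff:
  fixes s :: "nat \<Rightarrow> 'a::field"
  shows "s \<in> seqs.span S_circ \<longleftrightarrow> (\<forall>\<^sub>F k in sequentially. s k = 0)"
proof
  let ?Z = "{s :: nat \<Rightarrow> 'a. \<forall>\<^sub>F k in sequentially. s k = 0}"
  assume s: "s \<in> seqs.span S_circ"
  have "seqs.span S_circ \<subseteq> ?Z"
  proof (rule seqs.span_minimal)
    show "S_circ \<subseteq> ?Z"
      unfolding S_circ_def zero_seq_def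
      by (auto intro: eventually_mono[OF eventually_gt_at_top])
    show "seqs.subspace ?Z"
    proof (rule seqs.subspaceI)
      fix x y assume "x \<in> ?Z" "y \<in> ?Z"
      then have "\<forall>\<^sub>F k in sequentially. x k = 0 \<and> y k = 0" by (auto simp: eventually_conj_iff)
      then show "x + y \<in> ?Z" by (auto elim: eventually_mono)
    qed (auto simp: seq_scale_def elim: eventually_mono)
  qed
  with s show "\<forall>\<^sub>F k in sequentially. s k = 0" by blast
next
  assume "\<forall>\<^sub>F k in sequentially. s k = 0"
  then obtain K where K: "\<And>k. k \<ge> K \<Longrightarrow> s k = 0" unfolding eventually_sequentially by blast
  have "s k = (\<Sum>i<K. seq_scale (s i) (zero_seq i)) k" for k
  proof -
    have "(\<Sum>i<K. seq_scale (s i) (zero_seq i)) k = (\<Sum>i<K. if k = i then s i else 0)"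
      unfolding sum_seq_apply by (rule sum.cong) (auto simp: seq_scale_def zero_seq_def)
    then show ?thesis using K[of k] by (cases "k < K") auto
  qed
  then have "s = (\<Sum>i<K. seq_scale (s i) (zero_seq i))" by blast
  moreover have "(\<Sum>i<K. seq_scale (s i) (zero_seq i)) \<in> seqs.span S_circ"
    by (intro seqs.span_sum seqs.span_scale seqs.span_base) (simp add: S_circ_def)
  ultimately show "s \<in> seqs.span S_circ" by simp
qed

section \<open>The canonical form\<close>

text \<open>
  The \<open>(r, c)\<close> entry of \<open>\<A>\<^sub>0 \<Gamma>\<^sup>0 + \<A>\<^sub>1 \<Gamma>\<^sup>1 + \<dots>\<close> as the coefficient family of an exponential
  polynomial: the polynomial at the base \<open>a\<close> collects, for each \<open>i\<close>, the coordinate of the entry of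
  \<open>\<A>\<^sub>i\<close> at \<open>(a\<^sup>k)\<^sub>k\<close>. Plugging \<open>-k\<close> for \<open>k\<close> is then evaluation at a negative integer.
\<close>

definition entry_coeffs ::
  "nat \<Rightarrow> (nat \<Rightarrow> nat \<Rightarrow> 'a::field mat) \<Rightarrow> nat \<Rightarrow> nat \<Rightarrow> 'a \<Rightarrow> 'a poly" where
  "entry_coeffs q \<A> r c a =
     (\<Sum>i\<in>nonzero_terms q \<A>. monom (geom_coord (\<lambda>k. \<A> i k $$ (r, c)) a) i)"

lemma coeff_entry_coeffs:
  assumes "finite (nonzero_terms q \<A>)" "r < q" "c < q"
  shows "coeff (entry_coeffs q \<A> r c a) i = geom_coord (\<lambda>k. \<A> i k $$ (r, c)) a"
proof (cases "i \<in> nonzero_terms q \<A>")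
  case True
  then show ?thesis using assms(1) by (simp add: entry_coeffs_def coeff_sum)
next
  case False
  then have "(\<lambda>k. \<A> i k $$ (r, c)) = (\<lambda>k. 0)"
    using assms(2,3) by (auto simp: nonzero_terms_def)
  then have "geom_coord (\<lambda>k. \<A> i k $$ (r, c)) a = 0" by simp
  then show ?thesis using False assms(1) by (simp add: entry_coeffs_def coeff_sum)
qed

lemma exp_coeffs_entry_coeffs:
  assumes "finite (nonzero_terms q \<A>)"
  shows "exp_coeffs (entry_coeffs q \<A> r c)"
proof -
  let ?g = "\<lambda>i. geom_coord (\<lambda>k. \<A> i k $$ (r, c))"
  have "{a. entry_coeffs q \<A> r c a \<noteq> 0} \<subseteq> (\<Union>i\<in>nonzero_terms q \<A>. {a. ?g i a \<noteq> 0})"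
    by (auto simp: entry_coeffs_def intro!: sum.neutral)
  moreover have "finite (\<Union>i\<in>nonzero_terms q \<A>. {a. ?g i a \<noteq> 0})"
    using assms finite_geom_coord by blast
  ultimately have "finite {a. entry_coeffs q \<A> r c a \<noteq> 0}" by (rule finite_subset)
  then show ?thesis by (simp add: exp_coeffs_def) (simp add: entry_coeffs_def)
qed

lemma exp_sum_entry_coeffs:
  assumes "finite (nonzero_terms q \<A>)"
  shows "exp_sum (entry_coeffs q \<A> r c) z =
    (\<Sum>i\<in>nonzero_terms q \<A>.
      (\<Sum>a | geom_coord (\<lambda>k. \<A> i k $$ (r, c)) a \<noteq> 0.
        geom_coord (\<lambda>k. \<A> i k $$ (r, c)) a * a powi z) * of_int z ^ i)"
proof -
  let ?g = "\<lambda>i. geom_coord (\<lambda>k. \<A> i k $$ (r, c))"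
  let ?I = "nonzero_terms q \<A>"
  let ?S = "\<Union>i\<in>?I. {a. ?g i a \<noteq> 0}"
  have S: "finite ?S" using assms finite_geom_coord by auto
  have sub: "{a. entry_coeffs q \<A> r c a \<noteq> 0} \<subseteq> ?S"
    by (auto simp: entry_coeffs_def intro!: sum.neutral)
  have "exp_sum (entry_coeffs q \<A> r c) z = (\<Sum>a\<in>?S. \<Sum>i\<in>?I. ?g i a * a powi z * of_int z ^ i)"
    unfolding exp_sum_superset[OF S sub] entry_coeffs_def
    by (simp add: poly_sum poly_monom sum_distrib_left algebra_simps)
  also have "\<dots> = (\<Sum>i\<in>?I. (\<Sum>a\<in>?S. ?g i a * a powi z) * of_int z ^ i)"
    by (subst sum.swap) (simp add: sum_distrib_right)
  also have "\<dots> = (\<Sum>i\<in>?I. (\<Sum>a | ?g i a \<noteq> 0. ?g i a * a powi z) * of_int z ^ i)"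
  proof (rule sum.cong)
    fix i assume "i \<in> ?I"
    then have "(\<Sum>a\<in>?S. ?g i a * a powi z) = (\<Sum>a | ?g i a \<noteq> 0. ?g i a * a powi z)"
      by (intro sum.mono_neutral_right[OF S]) auto
    then show "(\<Sum>a\<in>?S. ?g i a * a powi z) * of_int z ^ i =
      (\<Sum>a | ?g i a \<noteq> 0. ?g i a * a powi z) * of_int z ^ i" by simp
  qed simp
  finally show ?thesis .
qed

lemma plug_neg_poly_index:
  assumes "finite (nonzero_terms q \<A>)" "r < q" "c < q"
  shows "plug_neg_poly q \<A> k $$ (r, c) = exp_sum (entry_coeffs q \<A> r c) (- int k)"
  using assms by (simp add: plug_neg_poly_def exp_sum_entry_coeffs plug_neg_eq)

lemma poly_seq_index:
  assumes "finite (nonzero_terms q \<A>)" "\<And>i. \<A> i \<in> seq_mats q (seqs.span S_star)" "r < q" "c < q"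
  shows "poly_seq q \<A> k $$ (r, c) = exp_sum (entry_coeffs q \<A> r c) (int k)"
proof -
  have "\<A> i k $$ (r, c) = (\<Sum>a | geom_coord (\<lambda>k. \<A> i k $$ (r, c)) a \<noteq> 0.
      geom_coord (\<lambda>k. \<A> i k $$ (r, c)) a * a ^ k)" for i
    using geom_coord_expansion[of "\<lambda>k. \<A> i k $$ (r, c)" k] assms(2)[of i] assms(3,4)
    by (simp add: seq_mats_def)
  then show ?thesis using assms by (simp add: poly_seq_def exp_sum_entry_coeffs)
qed

lemma canonical_form_tail:
  assumes A: "A \<in> carrier_mat q q" and form: "is_P_canonical_form A N \<A>"
  shows "\<forall>\<^sub>F k in sequentially. A ^\<^sub>m k = poly_seq q \<A> k"
proof -
  have dim: "dim_row A = q" using A by simp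
  have N: "N k \<in> carrier_mat q q" for k
    using form unfolding is_P_canonical_form_def seq_mats_def dim by blast
  have "\<forall>\<^sub>F k in sequentially. \<forall>r\<in>{..<q}. \<forall>c\<in>{..<q}. N k $$ (r, c) = 0"
    using form unfolding is_P_canonical_form_def seq_mats_def dim span_S_circ_iff
    by (intro eventually_ball_finite ballI) auto
  then show ?thesis
  proof eventually_elim
    case (elim k)
    have "A ^\<^sub>m k = N k + poly_seq q \<A> k"
      using form unfolding is_P_canonical_form_def dim by blast
    then show ?case using elim N[of k] by (intro eq_matI) (auto simp: poly_seq_def)
  qed
qed

lemma canonical_form_unique:
  fixes A :: "'a::field_char_0 mat"
  assumes A: "A \<in> carrier_mat q q"
    and form: "is_P_canonical_form A N \<A>" and form': "is_P_canonical_form A N' \<A>'"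
  shows "N = N' \<and> \<A> = \<A>'"
proof
  have dim: "dim_row A = q" using A by simp
  have fin: "finite (nonzero_terms q \<A>)" "finite (nonzero_terms q \<A>')"
    and S: "\<And>i. \<A> i \<in> seq_mats q (seqs.span S_star)" "\<And>i. \<A>' i \<in> seq_mats q (seqs.span S_star)"
    and N: "\<And>k. N k \<in> carrier_mat q q" "\<And>k. N' k \<in> carrier_mat q q"
    and eq: "\<And>k. A ^\<^sub>m k = N k + poly_seq q \<A> k" "\<And>k. A ^\<^sub>m k = N' k + poly_seq q \<A>' k"
    using form form' unfolding is_P_canonical_form_def dim by (auto simp: seq_mats_def)
  have coeffs: "entry_coeffs q \<A> r c = entry_coeffs q \<A>' r c" if "r < q" "c < q" for r c
  proof (rule exp_coeffs_unique[OF exp_coeffs_entry_coeffs exp_coeffs_entry_coeffs])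
    show "\<forall>\<^sub>F k in sequentially. exp_sum (entry_coeffs q \<A> r c) (int k) =
        exp_sum (entry_coeffs q \<A>' r c) (int k)"
      using canonical_form_tail[OF A form] canonical_form_tail[OF A form']
      by eventually_elim (use poly_seq_index fin S that in metis)
  qed (use fin in auto)
  have entry: "\<A> i k $$ (r, c) = \<A>' i k $$ (r, c)" if "r < q" "c < q" for i k r c
  proof -
    have "geom_coord (\<lambda>k. \<A> i k $$ (r, c)) = geom_coord (\<lambda>k. \<A>' i k $$ (r, c))"
      using coeffs[OF that] coeff_entry_coeffs[OF fin(1) that, of _ i]
        coeff_entry_coeffs[OF fin(2) that, of _ i] by (auto simp: fun_eq_iff)
    then show ?thesis
      using geom_coord_expansion[of "\<lambda>k. \<A> i k $$ (r, c)" k]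
        geom_coord_expansion[of "\<lambda>k. \<A>' i k $$ (r, c)" k] S that
      by (simp add: seq_mats_def)
  qed
  have "\<A> i k = \<A>' i k" for i k
  proof -
    have "\<A> i k \<in> carrier_mat q q" "\<A>' i k \<in> carrier_mat q q"
      using S unfolding seq_mats_def by auto
    then show ?thesis using entry by (intro eq_matI) auto
  qed
  then show eqA: "\<A> = \<A>'" by blast
  have "N k = N' k" for k
  proof (rule eq_matI)
    fix r c assume "r < dim_row (N' k)" "c < dim_col (N' k)"
    then have rc: "r < q" "c < q" using N(2)[of k] by auto
    have "N k + poly_seq q \<A> k = N' k + poly_seq q \<A> k"
      by (rule trans[OF eq(1)[symmetric]]) (simp only: eq(2) eqA)
    then have "(N k + poly_seq q \<A> k) $$ (r, c) = (N' k + poly_seq q \<A> k) $$ (r, c)"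
      by (rule arg_cong)
    then show "N k $$ (r, c) = N' k $$ (r, c)" using rc by (simp add: poly_seq_def)
  qed (use N[of k] in auto)
  then show "N = N'" by blast
qed

lemma canonical_form_exists:
  fixes A :: "'a::field_char_0 mat"
  assumes A: "A \<in> carrier_mat q q" and G: "exp_poly_mat q G"
    and pow_eq: "\<forall>\<^sub>F k in sequentially. A ^\<^sub>m k = G (int k)"
  shows "\<exists>N \<A>. is_P_canonical_form A N \<A>"
proof -
  have dim: "dim_row A = q" using A by simp
  have "\<forall>r c. \<exists>p. r < q \<longrightarrow> c < q \<longrightarrow> exp_coeffs p \<and> (\<lambda>k. G k $$ (r, c)) = exp_sum p"
    using G unfolding exp_poly_mat_def exp_poly_def by blast
  then obtain p where p: "\<And>r c. r < q \<Longrightarrow> c < q \<Longrightarrow> exp_coeffs (p r c)"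
    "\<And>r c k. r < q \<Longrightarrow> c < q \<Longrightarrow> G k $$ (r, c) = exp_sum (p r c) k"
    by (metis (no_types, lifting))
  define S where "S r c = {a. p r c a \<noteq> 0}" for r c
  have S: "finite (S r c)" "0 \<notin> S r c" if "r < q" "c < q" for r c
    using p(1)[OF that] by (auto simp: S_def exp_coeffs_def)
  define \<A> where "\<A> i k = mat q q (\<lambda>(r, c). \<Sum>a\<in>S r c. coeff (p r c a) i * a ^ k)" for i k
  have \<A>: "\<A> i \<in> seq_mats q (seqs.span S_star)" for i
  proof -
    have "(\<lambda>k. \<A> i k $$ (r, c)) \<in> seqs.span S_star" if rc: "r < q" "c < q" for r c
    proof -
      have "(\<lambda>k. \<A> i k $$ (r, c)) = (\<Sum>a\<in>S r c. seq_scale (coeff (p r c a) i) (geom_seq a))"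
        using rc by (auto simp: \<A>_def sum_seq_apply seq_scale_def geom_seq_def)
      also have "\<dots> \<in> seqs.span S_star"
        by (intro seqs.span_sum seqs.span_scale seqs.span_base) (use S(2)[OF rc] in \<open>auto simp: S_star_def\<close>)
      finally show ?thesis .
    qed
    then show ?thesis by (auto simp: seq_mats_def \<A>_def)
  qed
  let ?I = "nonzero_terms q \<A>"
  \<comment> \<open>A common bound for the degrees; the \<open>0\<close> keeps the set nonempty if all \<open>p\<close> vanish or \<open>q = 0\<close>.\<close>
  define D where "D = Max (insert 0 (\<Union>r\<in>{..<q}. \<Union>c\<in>{..<q}. (\<lambda>a. degree (p r c a)) ` S r c))"
  have D: "degree (p r c a) \<le> D" if "r < q" "c < q" "a \<in> S r c" for r c a
    unfolding D_def
  proof (rule Max_ge)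
    show "degree (p r c a) \<in>
        insert 0 (\<Union>r\<in>{..<q}. \<Union>c\<in>{..<q}. (\<lambda>a. degree (p r c a)) ` S r c)"
      using that by blast
  qed (use S(1) in simp)
  have I: "?I \<subseteq> {..D}"
  proof
    fix i assume i: "i \<in> ?I"
    show "i \<in> {..D}"
    proof (rule ccontr)
      assume "i \<notin> {..D}"
      then have "coeff (p r c a) i = 0" if "r < q" "c < q" "a \<in> S r c" for r c a
        using D[OF that] by (intro coeff_eq_0) simp
      then have "\<A> i k = 0\<^sub>m q q" for k by (intro eq_matI) (auto simp: \<A>_def)
      then show False using i by (auto simp: nonzero_terms_def)
    qed
  qed
  then have fin: "finite ?I" by (rule finite_subset) simp
  have poly_seq: "poly_seq q \<A> k = G (int k)" for k
  proof (rule eq_matI)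
    fix r c assume "r < dim_row (G (int k))" "c < dim_col (G (int k))"
    then have rc: "r < q" "c < q" using exp_poly_mat_carrier[OF G, of "int k"] by auto
    have "poly_seq q \<A> k $$ (r, c) = (\<Sum>i\<in>?I. \<A> i k $$ (r, c) * of_nat k ^ i)"
      using rc by (simp add: poly_seq_def)
    also have "\<dots> = (\<Sum>i\<le>D. \<A> i k $$ (r, c) * of_nat k ^ i)"
      by (rule sum.mono_neutral_left) (use I rc in \<open>auto simp: nonzero_terms_def\<close>)
    also have "\<dots> = (\<Sum>i\<le>D. \<Sum>a\<in>S r c. a ^ k * (coeff (p r c a) i * of_nat k ^ i))"
      using rc by (simp add: \<A>_def sum_distrib_left sum_distrib_right algebra_simps)
    also have "\<dots> = (\<Sum>a\<in>S r c. a ^ k * (\<Sum>i\<le>D. coeff (p r c a) i * of_nat k ^ i))"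
      by (subst sum.swap) (simp add: sum_distrib_left)
    also have "\<dots> = (\<Sum>a\<in>S r c. a ^ k * poly (p r c a) (of_nat k))"
    proof (rule sum.cong)
      fix a assume "a \<in> S r c"
      then have "(\<Sum>i\<le>D. coeff (p r c a) i * of_nat k ^ i) = poly (p r c a) (of_nat k)"
        unfolding poly_altdef using D[OF rc]
        by (intro sum.mono_neutral_right) (auto simp: coeff_eq_0)
      then show "a ^ k * (\<Sum>i\<le>D. coeff (p r c a) i * of_nat k ^ i) = a ^ k * poly (p r c a) (of_nat k)"
        by simp
    qed simp
    also have "\<dots> = G (int k) $$ (r, c)"
      by (simp add: p(2)[OF rc] exp_sum_def S_def)
    finally show "poly_seq q \<A> k $$ (r, c) = G (int k) $$ (r, c)" .
  qed (use exp_poly_mat_carrier[OF G, of "int k"] in \<open>auto simp: poly_seq_def\<close>)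
  define N where "N k = A ^\<^sub>m k - G (int k)" for k
  have N: "N k \<in> carrier_mat q q" for k
    unfolding N_def by (rule minus_carrier_mat[OF exp_poly_mat_carrier[OF G]])
  have "(\<lambda>k. N k $$ (r, c)) \<in> seqs.span S_circ" if "r < q" "c < q" for r c
    unfolding span_S_circ_iff using pow_eq
    by eventually_elim (use that carrier_matD[OF exp_poly_mat_carrier[OF G]] in \<open>auto simp: N_def\<close>)
  then have "N \<in> seq_mats q (seqs.span S_circ)" using N by (simp add: seq_mats_def)
  moreover have "A ^\<^sub>m k = N k + poly_seq q \<A> k" for k
    unfolding N_def poly_seq using A exp_poly_mat_carrier[OF G, of "int k"]
    by (intro eq_matI) auto
  ultimately have "is_P_canonical_form A N \<A>"
    using \<A> fin unfolding is_P_canonical_form_def dim by blast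
  then show ?thesis by blast
qed

lemma geometric_part_canonical:
  fixes A :: "'a::field_char_0 mat"
  assumes A: "A \<in> carrier_mat q q" and G: "exp_poly_mat q G"
    and pow_eq: "\<forall>\<^sub>F k in sequentially. A ^\<^sub>m k = G (int k)"
  shows "\<exists>N. is_P_canonical_form A N (geometric_part A)"
proof -
  obtain N \<A> where form: "is_P_canonical_form A N \<A>"
    using canonical_form_exists[OF assms] by blast
  have "P_canonical_form A = (N, \<A>)"
    unfolding P_canonical_form_def
  proof (rule the_equality)
    show "case (N, \<A>) of (N, \<A>) \<Rightarrow> is_P_canonical_form A N \<A>" using form by simp
    fix x assume "case x of (N, \<A>) \<Rightarrow> is_P_canonical_form A N \<A>"
    then have "is_P_canonical_form A (fst x) (snd x)" by (simp add: case_prod_beta)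
    from canonical_form_unique[OF A form this] show "x = (N, \<A>)" by (simp add: prod_eq_iff)
  qed
  then show ?thesis using form by (auto simp: geometric_part_def)
qed

lemma plug_neg_geometric_part:
  fixes A :: "'a::field_char_0 mat"
  assumes A: "A \<in> carrier_mat q q" and G: "exp_poly_mat q G"
    and pow_eq: "\<forall>\<^sub>F k in sequentially. A ^\<^sub>m k = G (int k)"
  shows "plug_neg_poly q (geometric_part A) k = G (- int k)"
proof -
  let ?\<A> = "geometric_part A"
  obtain N where form: "is_P_canonical_form A N ?\<A>"
    using geometric_part_canonical[OF assms] by blast
  have fin: "finite (nonzero_terms q ?\<A>)" and S: "\<And>i. ?\<A> i \<in> seq_mats q (seqs.span S_star)"
    using form A unfolding is_P_canonical_form_def by auto
  define H where "H z = mat q q (\<lambda>(r, c). exp_sum (entry_coeffs q ?\<A> r c) z)" for z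
  have H: "exp_poly_mat q H"
    using exp_coeffs_entry_coeffs[OF fin] unfolding exp_poly_mat_def H_def exp_poly_def by auto
  have poly_seq: "poly_seq q ?\<A> k = H (int k)" for k
    by (rule eq_matI) (use poly_seq_index[OF fin S] in \<open>auto simp: H_def poly_seq_def\<close>)
  have "\<forall>\<^sub>F k in sequentially. H (int k) = G (int k)"
    using canonical_form_tail[OF A form] pow_eq by eventually_elim (simp add: poly_seq)
  then have "H (- int k) = G (- int k)" by (rule exp_poly_mat_eqI[OF H G])
  moreover have "plug_neg_poly q ?\<A> k = H (- int k)"
    by (rule eq_matI) (use plug_neg_poly_index[OF fin] in \<open>auto simp: H_def plug_neg_poly_def\<close>)
  ultimately show ?thesis by simp
qed

section \<open>The geometric part at negative exponents\<close>

theorem theorem4p5: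
  fixes A :: "'a::field_char_0 mat" and q :: nat
  assumes "A \<in> carrier_mat q q"
    and "\<exists>as. char_poly A = (\<Prod>a\<leftarrow>as. [:- a, 1:])"
  shows "plug_neg_poly q (geometric_part A) =
    (\<lambda>k. drazin_inverse A ^\<^sub>m k - zero_seq 0 k \<cdot>\<^sub>m spectral_projection_0 A)"
proof
  fix k
  note A = assms(1)
  obtain as where split: "char_poly A = (\<Prod>a\<leftarrow>as. [:- a, 1:])" using assms(2) by blast
  obtain G where G: "exp_poly_mat q G" and pow_eq: "\<forall>\<^sub>F k in sequentially. A ^\<^sub>m k = G (int k)"
    using exp_poly_mat_powers[OF A split] by blast
  note ctxt = A G pow_eq
  have Gc: "G z \<in> carrier_mat q q" for z by (rule exp_poly_mat_carrier[OF G])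
  have P: "spectral_projection_0 A = 1\<^sub>m q - G 0" by (rule spectral_projection_0_eq[OF ctxt split])
  have "drazin_inverse A ^\<^sub>m k - zero_seq 0 k \<cdot>\<^sub>m spectral_projection_0 A = G (- int k)"
  proof (cases k)
    case 0
    have "dim_row (drazin_inverse A) = q" using carrier_matD[OF Gc] by (simp add: drazin_inverse_eq[OF ctxt])
    then show ?thesis
      unfolding P 0 using Gc[of 0] by (intro eq_matI) (auto simp: zero_seq_def)
  next
    case (Suc j)
    have "drazin_inverse A ^\<^sub>m k = G (- int k)"
      unfolding Suc by (rule drazin_inverse_pow[OF ctxt])
    then show ?thesis
      unfolding P using Suc Gc[of 0] Gc[of "- int k"]
      by (intro eq_matI) (auto simp: zero_seq_def)
  qed
  then show "plug_neg_poly q (geometric_part A) k =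
      drazin_inverse A ^\<^sub>m k - zero_seq 0 k \<cdot>\<^sub>m spectral_projection_0 A"
    using plug_neg_geometric_part[OF ctxt] by simp
qed

end
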